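(* (Maximum Principle) Let $\mathcal G\in\mathbf G_{\mathrm{fin}}$ be a metric graph with edge set $\mathcal E$ and vertex set $\mathcal V$, let $W\in L^\infty_{\mathrm{loc}}(\mathcal G)$ be a nonnegative function and let $\varphi\in C(\mathcal G)$ be a function such that, for every edge $e$, $\varphi\in W^{2,\infty}_{\mathrm{loc}}(e)$ (i.e. if $e$ is a bounded edge then $\varphi\in W^{2,\infty}(e)$, while if $e$ is a half-line $[0,+\infty)$ then $\varphi\in W^{2,\infty}(0,R)$ for every $R>0$). Assume that (i) $-\varphi''+W(x)\varphi\ge0$ (a.e.) in every edge $e$ of $\mathcal G$; (ii) for every vertex $v\in\mathcal V$: if $\varphi(v)<0$ then $\sum_{e\succ v}\frac{d\varphi_e}{dx}(v)\le0$. Then one of the following three possibilities applies: (a) $\varphi\ge0$ on $\mathcal G$; (b) there exists $C<0$ such that $\varphi\equiv C$ and $W\equiv0$ on $\mathcal G$; (c) $\inf_{\mathcal G}\varphi=-\infty$. In the third case, $\mathcal G$ contains at least one half-line along which $\lim_{x\to\infty}\varphi=-\infty$.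
   Context: Metric graphs: $\mathcal G=(\mathcal E,\mathcal V)$ with edges $\mathcal E$ and vertices $\mathcal V$; each bounded edge $e$ is identified with $[0,\ell_e]$ and each unbounded edge (half-line) with $[0,+\infty)$. $\mathbf G_{\mathrm{fin}}$ is the class of metric graphs that are connected, have finitely many vertices and edges, and whose edges all have positive (possibly infinite) length. $\varphi_e$ is the restriction of $\varphi$ to $e$. The notation $e\succ v$ means that $e$ is incident to $v$, and $\frac{d\varphi_e}{dx}(v)$ is the derivative of $\varphi$ along $e$ at $v$ directed away from $v$ (well defined, since $\varphi$ is $C^1$ on each edge up to its boundary). *)

theory Defs
  imports "HOL-Analysis.Analysis"
begin

text \<open>
  Every edge \<open>e\<close> carries a coordinate: it is identified with \<open>[0, len e]\<close> when \<open>len e < \<infinity>\<close>, and with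
  \<open>[0, \<infinity>)\<close> when \<open>len e = \<infinity>\<close>. The end with coordinate \<open>0\<close> is attached to the vertex \<open>src e\<close>; for a
  bounded edge the end with coordinate \<open>len e\<close> is attached to \<open>tgt e\<close>. The value of \<open>tgt e\<close> is
  irrelevant for a half-line. Loops and multiple edges are allowed.
\<close>

record ('v, 'e) metric_graph =
  verts :: "'v set"
  edges :: "'e set"
  len :: "'e \<Rightarrow> ereal"
  src :: "'e \<Rightarrow> 'v"
  tgt :: "'e \<Rightarrow> 'v"

datatype ('v, 'e) point = Vertex 'v | Inner 'e real

definition edge_dom :: "('v, 'e) metric_graph \<Rightarrow> 'e \<Rightarrow> real set" where
  "edge_dom G e = {x. 0 \<le> x \<and> ereal x \<le> len G e}"

definition edge_interior :: "('v, 'e) metric_graph \<Rightarrow> 'e \<Rightarrow> real set" where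
  "edge_interior G e = {x. 0 < x \<and> ereal x < len G e}"

definition edge_point :: "('v, 'e) metric_graph \<Rightarrow> 'e \<Rightarrow> real \<Rightarrow> ('v, 'e) point" where
  "edge_point G e x =
     (if x = 0 then Vertex (src G e)
      else if ereal x = len G e then Vertex (tgt G e)
      else Inner e x)"

definition points :: "('v, 'e) metric_graph \<Rightarrow> ('v, 'e) point set" where
  "points G = Vertex ` verts G \<union> (\<Union>e\<in>edges G. edge_point G e ` edge_dom G e)"

text \<open>
  The quotient topology obtained by gluing the edges at the vertices. For finitely many vertices and
  edges it is the topology of the shortest-path distance.
\<close>

definition graph_topology :: "('v, 'e) metric_graph \<Rightarrow> ('v, 'e) point topology" where
  "graph_topology G = topology (\<lambda>U. U \<subseteq> points G \<and>
     (\<forall>e\<in>edges G. openin (top_of_set (edge_dom G e)) {x \<in> edge_dom G e. edge_point G e x \<in> U}))"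

lemma openin_graph_topology:
  "openin (graph_topology G) U \<longleftrightarrow> U \<subseteq> points G \<and>
     (\<forall>e\<in>edges G. openin (top_of_set (edge_dom G e)) {x \<in> edge_dom G e. edge_point G e x \<in> U})"
proof -
  have "istopology (\<lambda>U. U \<subseteq> points G \<and>
     (\<forall>e\<in>edges G. openin (top_of_set (edge_dom G e)) {x \<in> edge_dom G e. edge_point G e x \<in> U}))"
    unfolding istopology_def
  proof (intro conjI allI impI ballI; (elim conjE)?)
    fix S T e
    assume "\<forall>e\<in>edges G. openin (top_of_set (edge_dom G e)) {x \<in> edge_dom G e. edge_point G e x \<in> S}"
      and "\<forall>e\<in>edges G. openin (top_of_set (edge_dom G e)) {x \<in> edge_dom G e. edge_point G e x \<in> T}"
      and "e \<in> edges G"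
    then have "openin (top_of_set (edge_dom G e))
        ({x \<in> edge_dom G e. edge_point G e x \<in> S} \<inter> {x \<in> edge_dom G e. edge_point G e x \<in> T})"
      by blast
    also have "{x \<in> edge_dom G e. edge_point G e x \<in> S} \<inter> {x \<in> edge_dom G e. edge_point G e x \<in> T}
        = {x \<in> edge_dom G e. edge_point G e x \<in> S \<inter> T}"
      by blast
    finally show "openin (top_of_set (edge_dom G e)) {x \<in> edge_dom G e. edge_point G e x \<in> S \<inter> T}" .
  next
    fix \<K> e
    assume K: "\<forall>K\<in>\<K>. K \<subseteq> points G \<and>
        (\<forall>e\<in>edges G. openin (top_of_set (edge_dom G e)) {x \<in> edge_dom G e. edge_point G e x \<in> K})"
      and e: "e \<in> edges G"
    have "openin (top_of_set (edge_dom G e)) (\<Union>K\<in>\<K>. {x \<in> edge_dom G e. edge_point G e x \<in> K})"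
      using K e by (intro openin_Union) auto
    also have "(\<Union>K\<in>\<K>. {x \<in> edge_dom G e. edge_point G e x \<in> K})
        = {x \<in> edge_dom G e. edge_point G e x \<in> \<Union>\<K>}"
      by blast
    finally show "openin (top_of_set (edge_dom G e)) {x \<in> edge_dom G e. edge_point G e x \<in> \<Union>\<K>}" .
  qed blast+
  then show ?thesis
    unfolding graph_topology_def by (simp add: topology_inverse')
qed

lemma topspace_graph_topology: "topspace (graph_topology G) = points G"
proof -
  have "{x \<in> edge_dom G e. edge_point G e x \<in> points G} = edge_dom G e" if "e \<in> edges G" for e
    using that by (auto simp: points_def)
  then have "openin (graph_topology G) (points G)"
    by (simp add: openin_graph_topology)
  then show ?thesis
    by (meson openin_graph_topology openin_subset openin_topspace subset_antisym)
qed

definition Gfin :: "('v, 'e) metric_graph \<Rightarrow> bool" where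
  "Gfin G \<longleftrightarrow>
     finite (verts G) \<and> verts G \<noteq> {} \<and> finite (edges G) \<and>
     (\<forall>e\<in>edges G. 0 < len G e \<and> src G e \<in> verts G \<and> (len G e < \<infinity> \<longrightarrow> tgt G e \<in> verts G)) \<and>
     connected_space (graph_topology G)"

definition on_edge ::
  "('v, 'e) metric_graph \<Rightarrow> 'e \<Rightarrow> (('v, 'e) point \<Rightarrow> real) \<Rightarrow> real \<Rightarrow> real" where
  "on_edge G e f x = f (edge_point G e x)"

text \<open>Vertices are null sets: only the Lebesgue measure along the edges matters.\<close>

definition AE_graph :: "('v, 'e) metric_graph \<Rightarrow> (('v, 'e) point \<Rightarrow> bool) \<Rightarrow> bool" where
  "AE_graph G P \<longleftrightarrow> (\<forall>e\<in>edges G. AE x\<in>edge_dom G e in lebesgue. P (edge_point G e x))"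


definition Linf :: "real set \<Rightarrow> (real \<Rightarrow> real) set" where
  "Linf I = {u. set_borel_measurable lebesgue I u \<and> (\<exists>M. AE x\<in>I in lebesgue. \<bar>u x\<bar> \<le> M)}"

definition Linf_loc_graph :: "('v, 'e) metric_graph \<Rightarrow> (('v, 'e) point \<Rightarrow> real) set" where
  "Linf_loc_graph G = {W. \<forall>K. compactin (graph_topology G) K \<longrightarrow>
     (\<forall>e\<in>edges G. on_edge G e W \<in> Linf {x \<in> edge_dom G e. edge_point G e x \<in> K})}"

definition test_function :: "real set \<Rightarrow> (real \<Rightarrow> real) \<Rightarrow> bool" where
  "test_function I \<psi> \<longleftrightarrow>
     (\<forall>k x. ((deriv ^^ k) \<psi>) field_differentiable (at x)) \<and>
     (\<exists>K. compact K \<and> K \<subseteq> I \<and> (\<forall>x. x \<notin> K \<longrightarrow> \<psi> x = 0))"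

definition loc_integrable :: "real set \<Rightarrow> (real \<Rightarrow> real) \<Rightarrow> bool" where
  "loc_integrable I u \<longleftrightarrow> (\<forall>K. compact K \<longrightarrow> K \<subseteq> I \<longrightarrow> set_integrable lebesgue K u)"

definition is_weak_deriv ::
  "nat \<Rightarrow> real set \<Rightarrow> (real \<Rightarrow> real) \<Rightarrow> (real \<Rightarrow> real) \<Rightarrow> bool" where
  "is_weak_deriv k I u g \<longleftrightarrow> loc_integrable I u \<and> loc_integrable I g \<and>
     (\<forall>\<psi>. test_function I \<psi> \<longrightarrow>
        (LINT x:I|lebesgue. u x * (deriv ^^ k) \<psi> x) = (-1) ^ k * (LINT x:I|lebesgue. g x * \<psi> x))"

text \<open>A representative of the weak derivative of order \<open>k\<close> on the open set \<open>I\<close>; it is unique a.e.\<close>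

definition weak_deriv :: "nat \<Rightarrow> real set \<Rightarrow> (real \<Rightarrow> real) \<Rightarrow> real \<Rightarrow> real" where
  "weak_deriv k I u = (SOME g. is_weak_deriv k I u g)"

definition sobolev_inf :: "nat \<Rightarrow> real set \<Rightarrow> (real \<Rightarrow> real) set" where
  "sobolev_inf k I = {u \<in> Linf I. \<forall>j\<in>{1..k}. \<exists>g\<in>Linf I. is_weak_deriv j I u g}"

definition W2inf_loc_edge :: "('v, 'e) metric_graph \<Rightarrow> 'e \<Rightarrow> (real \<Rightarrow> real) set" where
  "W2inf_loc_edge G e =
     (if len G e < \<infinity> then sobolev_inf 2 (edge_interior G e)
      else {u. \<forall>R>0. u \<in> sobolev_inf 2 {0<..<R}})"

text \<open>
  Sum over the edge ends at \<open>v\<close> of the derivatives directed away from \<open>v\<close>: the derivative with respect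
  to the coordinate at an end with coordinate \<open>0\<close>, and its opposite at the other end of a bounded edge.
  A loop at \<open>v\<close> has two ends there, and contributes twice.
\<close>

definition outgoing_deriv_sum ::
  "('v, 'e) metric_graph \<Rightarrow> (('v, 'e) point \<Rightarrow> real) \<Rightarrow> 'v \<Rightarrow> real" where
  "outgoing_deriv_sum G \<phi> v =
     (\<Sum>e\<in>{e \<in> edges G. src G e = v}.
        vector_derivative (on_edge G e \<phi>) (at 0 within edge_dom G e)) +
     (\<Sum>e\<in>{e \<in> edges G. len G e < \<infinity> \<and> tgt G e = v}.
        - vector_derivative (on_edge G e \<phi>) (at (real_of_ereal (len G e)) within edge_dom G e))"

end

theory Submission
  imports Defs
begin

text \<open>
  Along every edge \<open>\<psi> = min \<phi> 0\<close> is concave: where \<open>\<phi> < 0\<close> the inequality gives \<open>\<phi>'' \<le> W \<phi> \<le> 0\<close>, and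
  elsewhere \<open>\<psi>\<close> attains its maximum \<open>0\<close>. A concave function on a half-line either tends to \<open>-\<infinity>\<close> or
  stays above its value at the vertex. If no half-line is of the first kind, the minimum \<open>m\<close> of \<open>\<psi>\<close>
  over the graph is attained at a vertex. If \<open>m < 0\<close>, all outgoing derivatives of \<open>\<phi>\<close> at such a vertex
  are nonnegative, hence zero by the vertex condition, and concavity makes \<open>\<phi>\<close> constant on the
  incident edges. So \<open>{\<phi> = m}\<close> is open and closed, and \<open>\<phi> = m\<close> on the connected graph; then
  \<open>W m \<ge> 0\<close> forces \<open>W = 0\<close>.

  Weak derivatives enter through second differences: testing against smoothed tents shows that an
  upper bound \<open>c\<close> on the weak second derivative yields \<open>u (a + h) + u (a - h) - 2 u a \<le> 2 c h\<^sup>2\<close>. The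
  factor \<open>2\<close> is not optimal, but only the sign for \<open>c = 0\<close> and the order in \<open>h\<close> matter.
\<close>

subsection \<open>Smooth functions and test functions\<close>

text \<open>The recursion peels off the innermost derivative, so closure properties follow by
  induction with the function generalised. \<open>diff_times_iff\<close> recovers the iterated form
  in which test functions are defined.\<close>

primrec diff_times :: "nat \<Rightarrow> (real \<Rightarrow> real) \<Rightarrow> bool" where
  "diff_times 0 f = True"
| "diff_times (Suc n) f = ((\<forall>x. f field_differentiable at x) \<and> diff_times n (deriv f))"

definition smooth :: "(real \<Rightarrow> real) \<Rightarrow> bool" where
  "smooth f \<longleftrightarrow> (\<forall>n. diff_times n f)"

lemma diff_times_iff:
  "diff_times n f \<longleftrightarrow> (\<forall>k<n. \<forall>x. ((deriv ^^ k) f) field_differentiable at x)"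
proof (induction n arbitrary: f)
  case (Suc n)
  show ?case
    unfolding diff_times.simps Suc
    by (auto simp: less_Suc_eq_0_disj funpow_Suc_right simp del: funpow.simps)
qed simp

lemma smooth_iff: "smooth f \<longleftrightarrow> (\<forall>k x. ((deriv ^^ k) f) field_differentiable at x)"
  by (auto simp: smooth_def diff_times_iff)

lemma test_function_iff:
  "test_function I \<psi> \<longleftrightarrow> smooth \<psi> \<and> (\<exists>K. compact K \<and> K \<subseteq> I \<and> (\<forall>x. x \<notin> K \<longrightarrow> \<psi> x = 0))"
  by (simp add: test_function_def smooth_iff)

lemma diff_times_SucI:
  assumes "\<And>x. (f has_real_derivative f' x) (at x)" "diff_times n f'"
  shows "diff_times (Suc n) f"
proof -
  have "deriv f = f'"
    using assms(1) by (auto intro!: ext DERIV_imp_deriv)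
  then show ?thesis
    using assms by (auto simp: field_differentiable_def)
qed

lemma diff_times_SucD:
  assumes "diff_times (Suc n) f"
  shows "\<exists>f'. (\<forall>x. (f has_real_derivative f' x) (at x)) \<and> diff_times n f'"
  using assms DERIV_deriv_iff_field_differentiable by auto

lemma diff_times_lower: "diff_times (Suc n) f \<Longrightarrow> diff_times n f"
  by (induction n arbitrary: f) auto

lemma diff_times_const: "diff_times n (\<lambda>x. c)"
  by (induction n arbitrary: c) (auto intro!: diff_times_SucI[where f' = "\<lambda>x. 0"] simp del: diff_times.simps(2))

lemma diff_times_add: "diff_times n f \<Longrightarrow> diff_times n g \<Longrightarrow> diff_times n (\<lambda>x. f x + g x)"
proof (induction n arbitrary: f g)
  case (Suc n)
  obtain f' where f': "\<And>x. (f has_real_derivative f' x) (at x)" "diff_times n f'"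
    using diff_times_SucD[OF Suc.prems(1)] by blast
  obtain g' where g': "\<And>x. (g has_real_derivative g' x) (at x)" "diff_times n g'"
    using diff_times_SucD[OF Suc.prems(2)] by blast
  show ?case
    by (rule diff_times_SucI[OF DERIV_add[OF f'(1) g'(1)] Suc.IH[OF f'(2) g'(2)]])
qed simp

lemma diff_times_mult: "diff_times n f \<Longrightarrow> diff_times n g \<Longrightarrow> diff_times n (\<lambda>x. f x * g x)"
proof (induction n arbitrary: f g)
  case (Suc n)
  obtain f' where f': "\<And>x. (f has_real_derivative f' x) (at x)" "diff_times n f'"
    using diff_times_SucD[OF Suc.prems(1)] by blast
  obtain g' where g': "\<And>x. (g has_real_derivative g' x) (at x)" "diff_times n g'"
    using diff_times_SucD[OF Suc.prems(2)] by blast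
  \<comment> \<open>The undifferentiated factors reappear in the product rule; lowering their order
    makes the induction hypothesis apply to them.\<close>
  have "diff_times n (\<lambda>x. f' x * g x + g' x * f x)"
    using Suc.IH f'(2) g'(2) Suc.prems[THEN diff_times_lower] by (intro diff_times_add) auto
  with DERIV_mult[OF f'(1) g'(1)] show ?case
    by (rule diff_times_SucI)
qed simp

lemma diff_times_affine: "diff_times n f \<Longrightarrow> diff_times n (\<lambda>x. f (a * x + b))"
proof (induction n arbitrary: f)
  case (Suc n)
  obtain f' where f': "\<And>x. (f has_real_derivative f' x) (at x)" "diff_times n f'"
    using diff_times_SucD[OF Suc.prems(1)] by blast
  have "((\<lambda>x. f (a * x + b)) has_real_derivative f' (a * x + b) * a) (at x)" for x
    by (rule DERIV_chain2[OF f'(1)]) (auto intro!: derivative_eq_intros)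
  moreover have "diff_times n (\<lambda>x. f' (a * x + b) * a)"
    using Suc.IH[OF f'(2)] by (intro diff_times_mult diff_times_const) auto
  ultimately show ?case
    by (rule diff_times_SucI)
qed simp

lemma smooth_const: "smooth (\<lambda>x. c)"
  and smooth_add: "smooth f \<Longrightarrow> smooth g \<Longrightarrow> smooth (\<lambda>x. f x + g x)"
  and smooth_mult: "smooth f \<Longrightarrow> smooth g \<Longrightarrow> smooth (\<lambda>x. f x * g x)"
  and smooth_affine: "smooth f \<Longrightarrow> smooth (\<lambda>x. f (a * x + b))"
  by (auto simp: smooth_def diff_times_const diff_times_add diff_times_mult diff_times_affine)

lemma smooth_if_has_smooth_deriv:
  assumes "\<And>x. (f has_real_derivative f' x) (at x)" "smooth f'"
  shows "smooth f"
  unfolding smooth_def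
proof
  fix n show "diff_times n f"
  proof (cases n)
    case (Suc k)
    with assms diff_times_SucI[of f f' k] show ?thesis
      by (simp add: smooth_def del: diff_times.simps(2))
  qed simp
qed

lemma smooth_has_deriv: "smooth f \<Longrightarrow> (f has_real_derivative deriv f x) (at x)"
  unfolding smooth_def
  by (metis DERIV_deriv_iff_field_differentiable diff_times.simps(2))

lemma smooth_deriv: "smooth f \<Longrightarrow> smooth (deriv f)"
  unfolding smooth_def by (metis diff_times.simps(2))

lemma smooth_continuous: "smooth f \<Longrightarrow> continuous_on S f"
  by (meson smooth_has_deriv DERIV_continuous_on has_field_derivative_at_within)

section \<open>The flat function exp(-1/x)\<close>

lemma tendsto_poly_div_exp: "((\<lambda>x. poly p x / exp x) \<longlongrightarrow> (0::real)) at_top"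
proof -
  have "((\<lambda>x. \<Sum>i\<le>degree p. coeff p i * (x ^ i / exp x)) \<longlongrightarrow> (\<Sum>i\<le>degree p. coeff p i * 0)) at_top"
    by (intro tendsto_intros tendsto_power_div_exp_0)
  then show ?thesis
    by (simp add: poly_altdef sum_divide_distrib)
qed

text \<open>This family is closed under differentiation and contains \<open>flat\<close>, which is
  what makes \<open>flat\<close> smooth.\<close>

definition flat_poly :: "real poly \<Rightarrow> real \<Rightarrow> real" where
  "flat_poly p x = (if x > 0 then poly p (1 / x) * exp (- (1 / x)) else 0)"

text \<open>With t = 1/x one has dt/dx = -t^2, so p(t) exp(-t) has x-derivative t^2 (p(t) - p'(t))
  exp(-t); \<open>[:0, 0, 1:]\<close> is t^2. At 0 the difference quotient vanishes because the
  exponential beats every polynomial.\<close>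

lemma flat_poly_deriv:
  "(flat_poly p has_real_derivative flat_poly ([:0, 0, 1:] * (p - pderiv p)) x) (at x)"
proof -
  let ?q = "[:0, 0, 1:] * (p - pderiv p)"
  consider "x > 0" | "x < 0" | "x = 0" by linarith
  then show ?thesis
  proof cases
    case 1
    have "((\<lambda>x. poly p (1 / x) * exp (- (1 / x))) has_real_derivative flat_poly ?q x) (at x)"
      using 1 by (auto intro!: derivative_eq_intros DERIV_chain2[OF poly_DERIV]
          simp: flat_poly_def field_simps power2_eq_square)
    then show ?thesis
      by (rule has_field_derivative_transform_within_open[where S = "{0<..}"])
        (use 1 in \<open>auto simp: flat_poly_def\<close>)
  next
    case 2
    have "((\<lambda>x. 0) has_real_derivative flat_poly ?q x) (at x)"
      using 2 by (auto simp: flat_poly_def)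
    then show ?thesis
      by (rule has_field_derivative_transform_within_open[where S = "{..<0}"])
        (use 2 in \<open>auto simp: flat_poly_def\<close>)
  next
    case 3
    have "((\<lambda>h. flat_poly p h / h) \<longlongrightarrow> 0) (at_left 0)"
      by (rule tendsto_eventually) (auto simp: flat_poly_def eventually_at_filter)
    moreover have "((\<lambda>h. flat_poly p h / h) \<longlongrightarrow> 0) (at_right 0)"
    proof -
      \<comment> \<open>Substituting h = 1/t turns the quotient into t p(t) / exp t, whence the
        polynomial \<open>[:0,1:] * p\<close>.\<close>
      have "((\<lambda>t. flat_poly p (inverse t) / inverse t) \<longlongrightarrow> 0) at_top"
        by (rule Lim_transform_eventually[OF tendsto_poly_div_exp[of "[:0,1:] * p"]])
          (auto intro!: eventually_mono[OF eventually_gt_at_top[of 0]]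
            simp: flat_poly_def field_simps exp_minus)
      then show ?thesis
        by (simp add: filterlim_at_right_to_top)
    qed
    ultimately have "((\<lambda>h. flat_poly p h / h) \<longlongrightarrow> 0) (at 0)"
      by (simp add: filterlim_at_split)
    then show ?thesis
      using 3 by (simp add: DERIV_def flat_poly_def)
  qed
qed

lemma smooth_flat_poly: "smooth (flat_poly p)"
proof -
  have "diff_times n (flat_poly p)" for n
    by (induction n arbitrary: p) (auto intro: diff_times_SucI[OF flat_poly_deriv] simp del: diff_times.simps(2))
  then show ?thesis
    by (simp add: smooth_def)
qed

definition flat :: "real \<Rightarrow> real" where
  "flat x = (if x > 0 then exp (- (1 / x)) else 0)"

lemma smooth_flat: "smooth flat"
proof -
  have "flat = flat_poly 1"
    by (auto simp: flat_def flat_poly_def)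
  then show ?thesis
    by (metis smooth_flat_poly)
qed

lemma flat_nonneg: "0 \<le> flat x" and flat_le_1: "flat x \<le> 1"
  by (auto simp: flat_def)

subsection \<open>Second differences and weak second derivatives\<close>

lemma integrable_continuous_compact_support:
  fixes k :: "real \<Rightarrow> real"
  assumes "continuous_on UNIV k" "\<And>x. x \<notin> {A..B} \<Longrightarrow> k x = 0"
  shows "integrable lborel k"
proof -
  have "integrable lborel (\<lambda>x. indicator {A..B} x *\<^sub>R k x)"
    using assms(1) by (intro borel_integrable_compact) (auto intro: continuous_on_subset)
  moreover have "(\<lambda>x. indicator {A..B} x *\<^sub>R k x) = k"
    using assms(2) by (auto simp: indicator_def fun_eq_iff)
  ultimately show ?thesis by simp
qed

lemma antiderivative_exists:
  fixes f :: "real \<Rightarrow> real"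
  assumes "continuous_on UNIV f"
  shows "\<exists>F. \<forall>x. (F has_real_derivative f x) (at x)"
proof (intro exI allI)
  fix x :: real
  let ?F = "\<lambda>u. LBINT y=ereal 0..ereal u. f y"
  \<comment> \<open>This interval contains both 0 and x, with x in its interior, so the derivative
    within it is the full derivative.\<close>
  let ?J = "{- \<bar>x\<bar> - 1..\<bar>x\<bar> + 1}"
  have "(?F has_vector_derivative f x) (at x within ?J)"
    using assms by (intro interval_integral_FTC2) (auto intro: continuous_on_subset)
  moreover have "at x within ?J = at x"
    by (rule at_within_interior) auto
  ultimately show "(?F has_real_derivative f x) (at x)"
    by (simp add: has_real_derivative_iff_has_vector_derivative)
qed

text \<open>A smooth mollifier supported in [-\<epsilon>, \<epsilon>]. It is left unnormalised; its
  integral is carried along as \<open>S\<close>.\<close>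

definition bump :: "real \<Rightarrow> real \<Rightarrow> real" where
  "bump \<epsilon> x = flat (\<epsilon> + x) * flat (\<epsilon> - x)"

lemma smooth_bump: "smooth (bump \<epsilon>)"
proof -
  have "smooth (\<lambda>x. flat (1 * x + \<epsilon>) * flat (-1 * x + \<epsilon>))"
    by (intro smooth_mult smooth_affine smooth_flat)
  also have "(\<lambda>x. flat (1 * x + \<epsilon>) * flat (-1 * x + \<epsilon>)) = bump \<epsilon>"
    by (auto simp: bump_def fun_eq_iff add_ac)
  finally show ?thesis .
qed

lemma bump_nonneg: "0 \<le> bump \<epsilon> x"
  by (simp add: bump_def flat_nonneg)

lemma bump_pos: "\<bar>x\<bar> < \<epsilon> \<Longrightarrow> 0 < bump \<epsilon> x"
  by (auto simp: bump_def flat_def)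

lemma bump_outside: "\<epsilon> \<le> \<bar>x\<bar> \<Longrightarrow> bump \<epsilon> x = 0"
  by (auto simp: bump_def flat_def)

lemma smooth_shift: "smooth f \<Longrightarrow> smooth (\<lambda>x. f (x + t))"
  using smooth_affine[of f 1 t] by simp

text \<open>A smooth version of the tent function of half-width \<open>h\<close>: its second derivative tests the second
  difference of step \<open>h\<close>.\<close>

lemma tent_exists:
  assumes "0 < \<epsilon>" "0 < h"
  obtains \<psi> S where "smooth \<psi>" "0 < S"
    "\<And>x. (deriv ^^ 2) \<psi> x = bump \<epsilon> (x - a - h) + bump \<epsilon> (x - a + h) - 2 * bump \<epsilon> (x - a)"
    "\<And>x. 0 \<le> \<psi> x" "\<And>x. \<psi> x \<le> h * S" "\<And>x. x \<notin> {a - h - \<epsilon>..a + h + \<epsilon>} \<Longrightarrow> \<psi> x = 0"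
    "(\<integral>x. bump \<epsilon> x \<partial>lborel) = S"
proof -
  \<comment> \<open>\<open>E\<close> is a smoothed step and its antiderivative \<open>F\<close> a
    smoothed ramp, so that F'' is the bump.\<close>
  obtain E where E: "\<And>x. (E has_real_derivative bump \<epsilon> x) (at x)"
    using antiderivative_exists[OF smooth_continuous[OF smooth_bump]] by blast
  have sE: "smooth E"
    using E smooth_bump by (rule smooth_if_has_smooth_deriv)
  obtain F where F: "\<And>x. (F has_real_derivative E x) (at x)"
    using antiderivative_exists[OF smooth_continuous[OF sE]] by blast
  have sF: "smooth F"
    using F sE by (rule smooth_if_has_smooth_deriv)
  have mono: "E x \<le> E y" if "x \<le> y" for x y
    using DERIV_nonneg_imp_nondecreasing[OF that, of E] E bump_nonneg by blast
  have left: "E x = E (- \<epsilon>)" if "x \<le> - \<epsilon>" for x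
  proof (cases "x < - \<epsilon>")
    case True
    have "\<exists>z>x. z < - \<epsilon> \<and> E (- \<epsilon>) - E x = (- \<epsilon> - x) * bump \<epsilon> z"
      by (rule MVT2[OF True E])
    then show ?thesis by (auto simp: bump_outside)
  qed (use that in auto)
  have right: "E x = E \<epsilon>" if "\<epsilon> \<le> x" for x
  proof (cases "\<epsilon> < x")
    case True
    have "\<exists>z>\<epsilon>. z < x \<and> E x - E \<epsilon> = (x - \<epsilon>) * bump \<epsilon> z"
      by (rule MVT2[OF True E])
    then show ?thesis by (auto simp: bump_outside)
  qed (use that in auto)
  define S where "S = E \<epsilon> - E (- \<epsilon>)"
  have bounds: "E (- \<epsilon>) \<le> E x" "E x \<le> E \<epsilon>" for x
    using left[of x] right[of x] mono[of x "\<epsilon>"] mono[of "-\<epsilon>" x] by linarith+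
  have "0 < S"
  proof -
    have "\<exists>z>-\<epsilon>. z < \<epsilon> \<and> E \<epsilon> - E (-\<epsilon>) = (\<epsilon> - - \<epsilon>) * bump \<epsilon> z"
      by (rule MVT2) (use \<open>0 < \<epsilon>\<close> E in auto)
    then obtain z where "-\<epsilon> < z" "z < \<epsilon>" "S = (\<epsilon> - - \<epsilon>) * bump \<epsilon> z"
      unfolding S_def by blast
    then show ?thesis
      using bump_pos[of z \<epsilon>] \<open>0 < \<epsilon>\<close> by (simp add: abs_less_iff)
  qed
  have int: "(\<integral>x. bump \<epsilon> x \<partial>lborel) = S"
  proof -
    have "(\<integral>x. bump \<epsilon> x * indicator {-\<epsilon>..\<epsilon>} x \<partial>lborel) = E \<epsilon> - E (-\<epsilon>)"
      by (rule integral_FTC_Icc_nonneg)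
        (use \<open>0 < \<epsilon>\<close> E bump_nonneg in \<open>auto intro!: borel_measurable_continuous_onI smooth_continuous smooth_bump\<close>)
    moreover have "bump \<epsilon> x * indicator {-\<epsilon>..\<epsilon>} x = bump \<epsilon> x" for x
      by (cases "x \<in> {-\<epsilon>..\<epsilon>}") (auto simp: bump_outside)
    ultimately show ?thesis
      by (simp add: S_def)
  qed
  \<comment> \<open>The second difference of the ramp is a tent, and two derivatives of it give the
    second difference of the bump.\<close>
  define \<psi> where "\<psi> x = F (x + (- a - h)) + F (x + (- a + h)) + (-2) * F (x + (- a))" for x
  have smooth: "smooth \<psi>"
    unfolding \<psi>_def[abs_def] by (intro smooth_add smooth_mult smooth_const smooth_shift sF)
  have d1: "deriv \<psi> = (\<lambda>x. E (x + (- a - h)) + E (x + (- a + h)) + (-2) * E (x + (- a)))"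
    unfolding \<psi>_def[abs_def]
    by (rule ext, rule DERIV_imp_deriv) (auto intro!: derivative_eq_intros F DERIV_chain2[OF F])
  have d2: "deriv (deriv \<psi>) = (\<lambda>x. bump \<epsilon> (x + (- a - h)) + bump \<epsilon> (x + (- a + h)) + (-2) * bump \<epsilon> (x + (- a)))"
    unfolding d1
    by (rule ext, rule DERIV_imp_deriv) (auto intro!: derivative_eq_intros E DERIV_chain2[OF E])
  \<comment> \<open>The mean value theorem on either side of x - a writes \<psi> as h times an
    increment of the monotone step \<open>E\<close>. Sign, upper bound and support of \<psi> all
    follow from this form.\<close>
  have diff: "\<exists>y z. x - a - h \<le> y \<and> y \<le> z \<and> z \<le> x - a + h \<and> \<psi> x = h * (E z - E y)" for x
  proof -
    have "\<exists>z>x-a. z < x-a+h \<and> F (x-a+h) - F (x-a) = (x-a+h - (x-a)) * E z"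
      by (rule MVT2) (use \<open>0 < h\<close> F in auto)
    then obtain z where z: "z > x - a" "z < x-a+h" "F (x-a+h) - F (x-a) = h * E z"
      by auto
    have "\<exists>z>x-a-h. z < x-a \<and> F (x-a) - F (x-a-h) = (x-a - (x-a-h)) * E z"
      by (rule MVT2) (use \<open>0 < h\<close> F in auto)
    then obtain y where y: "y > x - a - h" "y < x-a" "F (x-a) - F (x-a-h) = h * E y"
      by auto
    have "\<psi> x = (F (x-a+h) - F (x-a)) - (F (x-a) - F (x-a-h))"
      by (simp add: \<psi>_def algebra_simps)
    also have "\<dots> = h * (E z - E y)"
      unfolding y z by (simp add: algebra_simps)
    finally show ?thesis
      using y(1,2) z(1,2) by (intro exI[of _ y] exI[of _ z]) auto
  qed
  show thesis
  proof (rule that[OF smooth \<open>0 < S\<close> _ _ _ _ int])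
    fix x
    show "(deriv ^^ 2) \<psi> x = bump \<epsilon> (x - a - h) + bump \<epsilon> (x - a + h) - 2 * bump \<epsilon> (x - a)"
      by (simp add: numeral_2_eq_2 d2 algebra_simps)
    obtain y z where yz: "x - a - h \<le> y" "y \<le> z" "z \<le> x - a + h" "\<psi> x = h * (E z - E y)"
      using diff by blast
    show "0 \<le> \<psi> x"
      using yz mono[of y z] \<open>0 < h\<close> by simp
    show "\<psi> x \<le> h * S"
      using yz(4) bounds[of y] bounds[of z] \<open>0 < h\<close> by (simp add: S_def)
    assume "x \<notin> {a - h - \<epsilon>..a + h + \<epsilon>}"
    then consider "x < a - h - \<epsilon>" | "x > a + h + \<epsilon>" by fastforce
    then show "\<psi> x = 0"
      using yz left[of y] left[of z] right[of y] right[of z] by cases auto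
  qed
qed

lemma integral_indicator_support:
  fixes k :: "real \<Rightarrow> real"
  assumes "\<And>x. x \<notin> I \<Longrightarrow> k x = 0"
  shows "(LINT x:I|lebesgue. k x) = (\<integral>x. k x \<partial>lebesgue)"
  unfolding set_lebesgue_integral_def
  using assms by (intro Bochner_Integration.integral_cong) (auto simp: indicator_def)

text \<open>If the inequality failed, continuity would keep the second differences above some
  \<open>K > 2 * c * h\<^sup>2\<close> for all centres near a. Testing with a smoothed tent then
  gives at least \<open>K * S\<close> on the side of u, but at most the maximum \<open>h * S\<close>
  of the tent times c times the length \<open>2 * h + 2 * \<epsilon>\<close> of its support on the
  side of g. Replacing the tent by its maximum is what costs the factor 2.\<close>

lemma weak_second_difference_le:
  fixes u g :: "real \<Rightarrow> real"
  assumes wd: "is_weak_deriv 2 I u g" and cont: "continuous_on {p..q} u" and sub: "{p..q} \<subseteq> I"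
    and ae: "AE x in lebesgue. x \<in> {p..q} \<longrightarrow> g x \<le> c" and "0 \<le> c" "0 < h" "p < a - h" "a + h < q"
  shows "u (a + h) + u (a - h) - 2 * u a \<le> 2 * c * h\<^sup>2"
proof (rule ccontr)
  \<comment> \<open>Clamping the argument extends u from [p, q] to a continuous function on the
    line, so that translated integrals make sense.\<close>
  define v where "v x = u (max p (min q x))" for x
  have v: "continuous_on UNIV v"
    unfolding v_def[abs_def]
    by (rule continuous_on_compose2[OF cont])
      (use assms in \<open>auto intro!: continuous_intros\<close>)
  have vu: "v x = u x" if "x \<in> {p..q}" for x
    using that by (simp add: v_def min_absorb2 max_absorb2)
  define D where "D y = v (a + y + h) + v (a + y - h) - 2 * v (a + y)" for y
  have D: "continuous_on UNIV D"
    unfolding D_def[abs_def] by (intro continuous_intros continuous_on_compose2[OF v]) auto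
  assume "\<not> ?thesis"
  then have "2 * c * h\<^sup>2 < D 0"
    using assms by (simp add: D_def vu)
  then obtain K where K: "2 * c * h\<^sup>2 < K" "K < D 0"
    using dense by blast
  obtain d where d: "d > 0" "\<And>y. \<bar>y\<bar> < d \<Longrightarrow> K < D y"
  proof -
    have "open {y. K < D y}"
      using D by (intro open_Collect_less continuous_on_const)
    then obtain d where "d > 0" "ball 0 d \<subseteq> {y. K < D y}"
      using K(2) by (metis mem_Collect_eq openE)
    then show thesis
      by (intro that[of d]) (auto simp: subset_eq dist_real_def)
  qed
  \<comment> \<open>The smoothing must be fine enough for the tent to stay inside [p, q], for
    \<open>D\<close> to exceed \<open>K\<close> on the support of the bump, and for the upper
    estimate to remain below \<open>K\<close>.\<close>
  have "\<forall>\<^sub>F \<epsilon> in at_right 0. \<epsilon> > 0 \<and> \<epsilon> < d \<and> \<epsilon> < (a - h) - p \<and> \<epsilon> < q - (a + h) \<and> c * h * (2 * h + 2 * \<epsilon>) < K"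
  proof (intro eventually_conj)
    have "((\<lambda>\<epsilon>. c * h * (2 * h + 2 * \<epsilon>)) \<longlongrightarrow> c * h * (2 * h + 2 * 0)) (at_right 0)"
      by (intro tendsto_intros)
    then show "\<forall>\<^sub>F \<epsilon> in at_right 0. c * h * (2 * h + 2 * \<epsilon>) < K"
      using K(1) by (auto simp: power2_eq_square algebra_simps dest!: order_tendstoD(2)[where a = K])
  qed (use d(1) assms in \<open>auto intro!: order_tendstoD(2)[OF tendsto_ident_at] simp: eventually_at_right_less\<close>)
  then obtain \<epsilon> where \<epsilon>: "\<epsilon> > 0" "\<epsilon> < d" "\<epsilon> < (a - h) - p" "\<epsilon> < q - (a + h)" "c * h * (2 * h + 2 * \<epsilon>) < K"
    using eventually_happens trivial_limit_at_right_real by blast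
  obtain \<psi> S where \<psi>: "smooth \<psi>" "0 < S"
    "\<And>x. (deriv ^^ 2) \<psi> x = bump \<epsilon> (x - a - h) + bump \<epsilon> (x - a + h) - 2 * bump \<epsilon> (x - a)"
    "\<And>x. 0 \<le> \<psi> x" "\<And>x. \<psi> x \<le> h * S" "\<And>x. x \<notin> {a - h - \<epsilon>..a + h + \<epsilon>} \<Longrightarrow> \<psi> x = 0"
    "(\<integral>x. bump \<epsilon> x \<partial>lborel) = S"
    using tent_exists[OF \<epsilon>(1) \<open>0 < h\<close>, of a] by metis
  let ?K = "{a - h - \<epsilon>..a + h + \<epsilon>}"
  have Kpq: "?K \<subseteq> {p..q}"
    using \<epsilon> by auto
  then have KI: "x \<notin> ?K" if "x \<notin> I" for x
    using sub that by blast
  have "test_function I \<psi>"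
    unfolding test_function_iff using \<psi>(1,6) Kpq sub by (intro conjI exI[of _ ?K]) auto
  then have eq: "(LINT x:I|lebesgue. u x * (deriv ^^ 2) \<psi> x) = (LINT x:I|lebesgue. g x * \<psi> x)"
    using wd by (simp add: is_weak_deriv_def)
  have out: "(deriv ^^ 2) \<psi> x = 0" if "x \<notin> ?K" for x
    unfolding \<psi>(3) using that \<open>0 < h\<close> by (subst bump_outside; simp add: abs_if; linarith?)+
  have contb: "continuous_on UNIV (\<lambda>x. bump \<epsilon> (x + t))" for t
    by (intro smooth_continuous smooth_shift smooth_bump)
  have int1: "integrable lborel (\<lambda>y. v (y + t) * bump \<epsilon> y)" for t
    by (rule integrable_continuous_compact_support[of _ "-\<epsilon>" \<epsilon>])
      (auto intro!: continuous_intros continuous_on_compose2[OF v] smooth_continuous[OF smooth_bump] bump_outside)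
  have shift: "(\<integral>x. v x * bump \<epsilon> (x - t) \<partial>lborel) = (\<integral>y. v (y + t) * bump \<epsilon> y \<partial>lborel)" for t
    using lborel_integral_real_affine[of 1 "\<lambda>x. v x * bump \<epsilon> (x - t)" t] by (simp add: add_ac)
  have int2: "integrable lborel (\<lambda>x. v x * bump \<epsilon> (x - t))" for t
    by (rule integrable_continuous_compact_support[of _ "t-\<epsilon>" "t+\<epsilon>"])
      (use contb[of "-t"] in \<open>auto intro!: continuous_on_mult v bump_outside\<close>)
  \<comment> \<open>Translating the three bumps to the origin turns the tested integral into the
    integral of \<open>D\<close> against one bump.\<close>
  have "(LINT x:I|lebesgue. u x * (deriv ^^ 2) \<psi> x) = (\<integral>x. u x * (deriv ^^ 2) \<psi> x \<partial>lebesgue)"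
    using out[OF KI] by (intro integral_indicator_support) simp
  also have "\<dots> =
      (\<integral>x. v x * bump \<epsilon> (x - (a + h)) + v x * bump \<epsilon> (x - (a - h)) - 2 * (v x * bump \<epsilon> (x - a)) \<partial>lebesgue)"
  proof (rule Bochner_Integration.integral_cong[OF refl])
    fix x
    have "u x * (deriv ^^ 2) \<psi> x = v x * (deriv ^^ 2) \<psi> x"
      using out[of x] vu[of x] Kpq by (cases "x \<in> ?K") auto
    then show "u x * (deriv ^^ 2) \<psi> x =
       v x * bump \<epsilon> (x - (a + h)) + v x * bump \<epsilon> (x - (a - h)) - 2 * (v x * bump \<epsilon> (x - a))"
      unfolding \<psi>(3) by (simp add: algebra_simps)
  qed
  also have "\<dots> = (\<integral>x. v x * bump \<epsilon> (x - (a + h)) + v x * bump \<epsilon> (x - (a - h)) - 2 * (v x * bump \<epsilon> (x - a)) \<partial>lborel)"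
    using int2 by (intro integral_completion) (auto intro!: borel_measurable_integrable Bochner_Integration.integrable_add Bochner_Integration.integrable_diff)
  also have "\<dots> = (\<integral>y. v (y + (a + h)) * bump \<epsilon> y \<partial>lborel) + (\<integral>y. v (y + (a - h)) * bump \<epsilon> y \<partial>lborel)
      - 2 * (\<integral>y. v (y + a) * bump \<epsilon> y \<partial>lborel)"
    using int2 by (simp add: shift)
  also have "\<dots> = (\<integral>y. v (y + (a + h)) * bump \<epsilon> y + v (y + (a - h)) * bump \<epsilon> y - 2 * (v (y + a) * bump \<epsilon> y) \<partial>lborel)"
    using int1 by simp
  also have "\<dots> \<ge> (\<integral>y. K * bump \<epsilon> y \<partial>lborel)"
  proof (rule integral_mono)
    show "integrable lborel (\<lambda>y. K * bump \<epsilon> y)"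
      by (rule integrable_continuous_compact_support[of _ "-\<epsilon>" \<epsilon>])
        (auto intro!: continuous_intros smooth_continuous[OF smooth_bump] bump_outside)
    show "integrable lborel (\<lambda>y. v (y + (a + h)) * bump \<epsilon> y + v (y + (a - h)) * bump \<epsilon> y - 2 * (v (y + a) * bump \<epsilon> y))"
      using int1 by simp
    fix y
    have "v (y + (a + h)) * bump \<epsilon> y + v (y + (a - h)) * bump \<epsilon> y - 2 * (v (y + a) * bump \<epsilon> y) = D y * bump \<epsilon> y"
      by (simp add: D_def algebra_simps)
    also have "\<dots> \<ge> K * bump \<epsilon> y"
      using d(2)[of y] \<epsilon>(2) bump_outside[of \<epsilon> y] bump_nonneg[of \<epsilon> y]
      by (cases "\<bar>y\<bar> < \<epsilon>") (auto intro!: mult_right_mono)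
    finally show "K * bump \<epsilon> y \<le> v (y + (a + h)) * bump \<epsilon> y + v (y + (a - h)) * bump \<epsilon> y - 2 * (v (y + a) * bump \<epsilon> y)" .
  qed
  finally have "K * S \<le> (LINT x:I|lebesgue. u x * (deriv ^^ 2) \<psi> x)"
    using \<psi>(7) by simp
  also have "\<dots> = (\<integral>x. g x * \<psi> x \<partial>lebesgue)"
    unfolding eq using \<psi>(6)[OF KI] by (intro integral_indicator_support) simp
  also have "\<dots> \<le> (\<integral>x. (c * h * S) * indicator ?K x \<partial>lebesgue)"
  proof (rule integral_mono_AE')
    show "integrable lebesgue (\<lambda>x. (c * h * S) * indicator ?K x)"
      by (intro integrable_mult_right integrable_real_indicator) (auto simp: emeasure_lborel_Icc_eq)
    show "AE x in lebesgue. g x * \<psi> x \<le> (c * h * S) * indicator ?K x"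
      using ae
    proof eventually_elim
      case (elim x)
      show ?case
      proof (cases "x \<in> ?K")
        case True
        then have "g x * \<psi> x \<le> c * (h * S)"
          using elim Kpq \<psi>(4,5)[of x] \<open>0 \<le> c\<close>
          by (meson mult_right_mono mult_left_mono order_trans subsetD)
        with True show ?thesis by simp
      qed (simp add: \<psi>(6))
    qed
    show "AE x in lebesgue. 0 \<le> (c * h * S) * indicator ?K x"
      using \<open>0 \<le> c\<close> \<open>0 < h\<close> \<psi>(2) by (intro AE_I2) auto
  qed
  also have "\<dots> = c * h * S * (2 * h + 2 * \<epsilon>)"
    using \<epsilon> \<open>0 < h\<close> by simp
  finally have "K * S \<le> c * h * (2 * h + 2 * \<epsilon>) * S"
    by (simp add: mult_ac)
  then show False
    using \<epsilon>(5) \<psi>(2) by simp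
qed

subsection \<open>Uniqueness, restriction and gluing of weak derivatives\<close>

text \<open>Open lower half-lines form an intersection-stable generator of the Borel sets, so the
  integrals over all Borel sets vanish by a Dynkin argument; the total integral handles complements.
  Uniqueness of densities finishes the proof.\<close>

lemma AE_eq_0_if_integrals_0:
  fixes d :: "real \<Rightarrow> real"
  assumes int: "integrable lborel d" and total: "(\<integral>x. d x \<partial>lborel) = 0"
    and below: "\<And>a. (LINT x:{..<a}|lborel. d x) = 0"
  shows "AE x in lborel. d x = 0"
proof -
  have set_int: "set_integrable lborel A d" if "A \<in> sets borel" for A
    using that int by (metis UNIV_I integrable_mult_indicator set_integrable_def sets_lborel)
  have stable: "Int_stable (range (lessThan :: real \<Rightarrow> _))"
  proof (clarsimp simp: Int_stable_def)
    fix a b :: real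
    have "{..<a} \<inter> {..<b} = {..<min a b}" by auto
    then show "{..<a} \<inter> {..<b} \<in> range lessThan" by blast
  qed
  have pow: "range (lessThan :: real \<Rightarrow> _) \<subseteq> Pow UNIV"
    by simp
  have zero: "(LINT x:A|lborel. d x) = 0" if "A \<in> sets borel" for A
  proof -
    have "A \<in> sigma_sets UNIV (range (lessThan :: real \<Rightarrow> _))"
      using that by (simp add: borel_Iio)
    then show ?thesis
    proof (induction rule: sigma_sets_induct_disjoint[OF stable pow, consumes 1, case_names basic empty compl union])
      case (compl A)
      have A: "A \<in> sets borel"
        using compl(1) by (simp add: borel_Iio)
      have "(LINT x:UNIV|lborel. d x) = (LINT x:A|lborel. d x) + (LINT x:UNIV - A|lborel. d x)"
        using A by (subst set_integral_Un[symmetric]) (auto intro!: set_int simp: Un_absorb1)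
      then show ?case
        using total compl by (simp add: set_lebesgue_integral_def)
    next
      case (union A)
      have A: "A i \<in> sets borel" for i
        using union(2) by (auto simp: borel_Iio)
      have "(LINT x:(\<Union>i. A i)|lborel. d x) = (\<Sum>i. (LINT x:(A i)|lborel. d x))"
        using A union(1)
        by (intro lebesgue_integral_countable_add set_int) (auto simp: disjoint_family_on_def)
      then show ?case
        using union(3) by simp
    next
      case (basic A)
      then show ?case using below by auto
    qed (simp add: set_lebesgue_integral_def)
  qed
  show ?thesis
    by (rule density_unique_real[of lborel d "\<lambda>x. 0"])
      (use int zero in \<open>auto simp: set_lebesgue_integral_def\<close>)
qed

lemma deriv_pow_0_outside:
  fixes \<psi> :: "real \<Rightarrow> real"
  assumes "closed K" "\<And>x. x \<notin> K \<Longrightarrow> \<psi> x = 0" "x \<notin> K"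
  shows "(deriv ^^ k) \<psi> x = 0"
  using assms(3)
proof (induction k arbitrary: x)
  case (Suc k)
  have "((\<lambda>x. 0) has_real_derivative 0) (at x)" by simp
  then have "((deriv ^^ k) \<psi> has_real_derivative 0) (at x)"
    by (rule has_field_derivative_transform_within_open[where S = "- K"])
      (use assms(1) Suc in auto)
  then show ?case
    by (simp add: DERIV_imp_deriv)
qed (use assms(2) in auto)

lemma weak_derivD:
  assumes "is_weak_deriv k I u g" "test_function I \<psi>"
  shows "(LINT x:I|lebesgue. u x * (deriv ^^ k) \<psi> x) = (-1) ^ k * (LINT x:I|lebesgue. g x * \<psi> x)"
  using assms by (simp add: is_weak_deriv_def)

text \<open>A test function on J is one on I, and the integrands vanish off its support, so both
  domains give the same integrals.\<close>

lemma weak_deriv_subset: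
  assumes "is_weak_deriv k I u g" "J \<subseteq> I"
  shows "is_weak_deriv k J u g"
  unfolding is_weak_deriv_def
proof (intro conjI allI impI)
  show "loc_integrable J u" "loc_integrable J g"
    using assms by (auto simp: is_weak_deriv_def loc_integrable_def)
  fix \<psi> assume \<psi>: "test_function J \<psi>"
  then obtain K where K: "compact K" "K \<subseteq> J" "\<And>x. x \<notin> K \<Longrightarrow> \<psi> x = 0"
    by (auto simp: test_function_iff)
  have "test_function I \<psi>"
    using \<psi> assms(2) by (auto simp: test_function_iff)
  then have "(LINT x:I|lebesgue. u x * (deriv ^^ k) \<psi> x) = (-1) ^ k * (LINT x:I|lebesgue. g x * \<psi> x)"
    using assms(1) by (simp add: is_weak_deriv_def)
  moreover have "(LINT x:L|lebesgue. u x * (deriv ^^ k) \<psi> x) = (\<integral>x. u x * (deriv ^^ k) \<psi> x \<partial>lebesgue)"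
      "(LINT x:L|lebesgue. g x * \<psi> x) = (\<integral>x. g x * \<psi> x \<partial>lebesgue)" if "J \<subseteq> L" for L
    using K(2) that deriv_pow_0_outside[OF compact_imp_closed[OF K(1)] K(3)]
    by (intro integral_indicator_support; use K(3) in fastforce)+
  ultimately show "(LINT x:J|lebesgue. u x * (deriv ^^ k) \<psi> x) = (-1) ^ k * (LINT x:J|lebesgue. g x * \<psi> x)"
    using assms(2) by simp
qed

lemma borel_measurable_lebesgue_smooth: "smooth f \<Longrightarrow> f \<in> borel_measurable lebesgue"
  by (intro measurable_completion) (simp add: borel_measurable_continuous_onI smooth_continuous)

text \<open>The test function is bounded on its compact support, where g is integrable.\<close>

lemma integrable_mult_test_function:
  assumes "loc_integrable I g" "test_function I \<psi>"
  shows "integrable lebesgue (\<lambda>x. g x * \<psi> x)"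
proof -
  obtain K where K: "compact K" "K \<subseteq> I" "\<And>x. x \<notin> K \<Longrightarrow> \<psi> x = 0" and \<psi>: "smooth \<psi>"
    using assms(2) by (auto simp: test_function_iff)
  have gK: "integrable lebesgue (\<lambda>x. indicator K x *\<^sub>R g x)"
    using assms(1) K(1,2) by (simp add: loc_integrable_def set_integrable_def)
  have "compact (\<psi> ` K)"
    using K(1) \<psi> by (intro compact_continuous_image smooth_continuous)
  then obtain B where B: "\<And>x. x \<in> K \<Longrightarrow> \<bar>\<psi> x\<bar> \<le> B"
    by (metis bounded_real compact_imp_bounded imageI)
  have eq: "(\<lambda>x. g x * \<psi> x) = (\<lambda>x. (indicator K x *\<^sub>R g x) * \<psi> x)"
    using K(3) by (auto simp: indicator_def fun_eq_iff)
  show ?thesis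
    unfolding eq
  proof (rule Bochner_Integration.integrable_bound)
    show "integrable lebesgue (\<lambda>x. B * (indicator K x *\<^sub>R g x))"
      using gK by simp
    show "(\<lambda>x. indicator K x *\<^sub>R g x * \<psi> x) \<in> borel_measurable lebesgue"
      using gK borel_measurable_lebesgue_smooth[OF \<psi>] by (intro borel_measurable_times) auto
    have "norm (indicator K x *\<^sub>R g x * \<psi> x) \<le> norm (B * (indicator K x *\<^sub>R g x))" for x
      using B[of x] mult_right_mono[of "\<bar>\<psi> x\<bar>" "\<bar>B\<bar>" "\<bar>g x\<bar>"]
      by (auto simp: indicator_def abs_mult mult.commute)
    then show "AE x in lebesgue. norm (indicator K x *\<^sub>R g x * \<psi> x) \<le> norm (B * (indicator K x *\<^sub>R g x))"
      by simp
  qed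
qed

text \<open>Products of two such dilations approximate the indicator of an open interval by test
  functions.\<close>

lemma flat_tendsto_1:
  assumes "0 < t"
  shows "(\<lambda>n. flat (real (Suc n) * t)) \<longlonglongrightarrow> 1"
proof -
  have "(\<lambda>n. exp (- (inverse (real (Suc n)) * inverse t))) \<longlonglongrightarrow> exp (- (0 * inverse t))"
    by (intro tendsto_intros LIMSEQ_inverse_real_of_nat)
  moreover have "exp (- (inverse (real (Suc n)) * inverse t)) = flat (real (Suc n) * t)" for n
    using assms by (simp add: flat_def divide_inverse zero_less_mult_iff del: of_nat_Suc)
  ultimately show ?thesis by simp
qed

text \<open>Test functions converging boundedly to the indicator of (p, b) show that the difference
  of the two derivatives integrates to 0 over every such interval, which forces it to vanish almost
  everywhere.\<close>

lemma weak_deriv_unique_on_interval: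
  assumes g1: "is_weak_deriv k I u g1" and g2: "is_weak_deriv k I u g2"
    and sub: "{p..q} \<subseteq> I" and "p < q"
  shows "AE x in lebesgue. x \<in> {p..q} \<longrightarrow> g1 x = g2 x"
proof -
  \<comment> \<open>Local integrability gives integrability only on compact sets, hence the
    cut-off.\<close>
  define d where "d x = indicator {p..q} x *\<^sub>R (g1 x - g2 x)" for x
  have "set_integrable lebesgue {p..q} g1" "set_integrable lebesgue {p..q} g2"
    using g1 g2 sub by (auto simp: is_weak_deriv_def loc_integrable_def)
  then have int_d: "integrable lebesgue d"
    unfolding d_def[abs_def] by (metis set_integrable_def set_integral_diff(1))
  have zero: "(\<integral>x. indicator {p<..<b} x * d x \<partial>lebesgue) = 0" if "p < b" "b \<le> q" for b
  proof -
    \<comment> \<open>Each factor tends to 1 strictly inside (p, b), while the product vanishes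
      outside; values in [0, 1] allow dominated convergence.\<close>
    define \<psi> where "\<psi> n x = flat (real (Suc n) * (x - p)) * flat (real (Suc n) * (b - x))" for n x
    have \<psi>_0: "\<psi> n x = 0" if "x \<notin> {p<..<b}" for n x
      using that by (auto simp: \<psi>_def flat_def zero_less_mult_iff)
    have \<psi>_bounds: "0 \<le> \<psi> n x" "\<psi> n x \<le> 1" for n x
      by (auto simp: \<psi>_def flat_nonneg flat_le_1 mult_le_one)
    have smooth: "smooth (\<psi> n)" for n
    proof -
      have "smooth (\<lambda>x. flat (real (Suc n) * x + (- real (Suc n) * p)) * flat (- real (Suc n) * x + real (Suc n) * b))"
        by (intro smooth_mult smooth_affine smooth_flat)
      moreover have "(\<lambda>x. flat (real (Suc n) * x + (- real (Suc n) * p)) * flat (- real (Suc n) * x + real (Suc n) * b)) = \<psi> n"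
        by (auto simp: \<psi>_def fun_eq_iff algebra_simps)
      ultimately show ?thesis
        by simp
    qed
    have test: "test_function I (\<psi> n)" for n
      unfolding test_function_iff using smooth \<psi>_0 that sub
      by (intro conjI exI[of _ "{p..b}"]) auto
    have int_0: "(\<integral>x. d x * \<psi> n x \<partial>lebesgue) = 0" for n
    proof -
      have eq: "d x * \<psi> n x = g1 x * \<psi> n x - g2 x * \<psi> n x" for x
        using \<psi>_0[of x n] that by (cases "x \<in> {p<..<b}") (auto simp: d_def algebra_simps)
      have supp: "(LINT x:I|lebesgue. g x * \<psi> n x) = (\<integral>x. g x * \<psi> n x \<partial>lebesgue)" for g
      proof (rule integral_indicator_support)
        fix x assume "x \<notin> I"
        then have "x \<notin> {p<..<b}" using sub that by (auto simp: subset_eq)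
        then show "g x * \<psi> n x = 0" by (simp add: \<psi>_0)
      qed
      have "(-1) ^ k * (LINT x:I|lebesgue. g1 x * \<psi> n x) = (-1) ^ k * (LINT x:I|lebesgue. g2 x * \<psi> n x)"
        using weak_derivD[OF g1 test] weak_derivD[OF g2 test] by (rule trans[OF sym])
      then have "(\<integral>x. g1 x * \<psi> n x \<partial>lebesgue) = (\<integral>x. g2 x * \<psi> n x \<partial>lebesgue)"
        by (simp add: supp)
      then show ?thesis
        using integrable_mult_test_function[OF _ test] g1 g2 by (simp add: eq is_weak_deriv_def)
    qed
    have "(\<lambda>n. \<integral>x. d x * \<psi> n x \<partial>lebesgue) \<longlonglongrightarrow> (\<integral>x. indicator {p<..<b} x * d x \<partial>lebesgue)"
    proof (rule integral_dominated_convergence[where w = "\<lambda>x. norm (d x)"])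
      show "AE x in lebesgue. (\<lambda>n. d x * \<psi> n x) \<longlonglongrightarrow> indicator {p<..<b} x * d x"
      proof (rule AE_I2)
        fix x
        show "(\<lambda>n. d x * \<psi> n x) \<longlonglongrightarrow> indicator {p<..<b} x * d x"
        proof (cases "x \<in> {p<..<b}")
          case True
          then have "(\<lambda>n. d x * \<psi> n x) \<longlonglongrightarrow> d x * (1 * 1)"
            unfolding \<psi>_def by (intro tendsto_intros flat_tendsto_1) auto
          with True show ?thesis by simp
        qed (simp add: \<psi>_0)
      qed
      show "AE x in lebesgue. norm (d x * \<psi> n x) \<le> norm (d x)" for n
        using \<psi>_bounds by (auto simp: abs_mult mult_left_le)
      show "(\<lambda>x. d x * \<psi> n x) \<in> borel_measurable lebesgue" for n
        using int_d borel_measurable_lebesgue_smooth[OF smooth] by (intro borel_measurable_times) auto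
      show "(\<lambda>x. indicator {p<..<b} x * d x) \<in> borel_measurable lebesgue"
        using int_d by (intro borel_measurable_times borel_measurable_indicator) auto
    qed (use int_d in auto)
    then have "(\<lambda>n::nat. 0) \<longlonglongrightarrow> (\<integral>x. indicator {p<..<b} x * d x \<partial>lebesgue)"
      by (simp only: int_0)
    then show ?thesis
      by (simp add: LIMSEQ_const_iff)
  qed
  \<comment> \<open>The Dynkin argument runs over \<open>lborel\<close>, so the Lebesgue measurable
    \<open>d\<close> is exchanged for a Borel version.\<close>
  obtain d' where d': "d' \<in> borel_measurable lborel" "AE x in lborel. d x = d' x"
    using completion_ex_borel_measurable_real[of d lborel] int_d by auto
  have ae: "AE x in lebesgue. d x = d' x"
    using d'(2) by (rule AE_completion)
  have d'_leb: "d' \<in> borel_measurable lebesgue"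
    using d'(1) by (rule measurable_completion)
  have "integrable lebesgue d'"
    using int_d ae d'_leb by (subst integrable_cong_AE[of _ _ d]) auto
  then have int_d': "integrable lborel d'"
    using integrable_completion[OF d'(1)] by simp
  \<comment> \<open>The set \<open>A\<close> may differ from (p, b) at the null points p, q and
    outside [p, q], where \<open>d\<close> is 0. This covers the whole line with b = q and the
    half-line below a with b = min a q; for b at most p the interval is empty.\<close>
  have conv: "(\<integral>x. indicator A x * d' x \<partial>lborel) = 0"
    if A: "A \<in> sets borel" and b: "b \<le> q"
      and Ab: "\<And>x. x \<noteq> p \<Longrightarrow> x \<noteq> q \<Longrightarrow> x \<in> {p..q} \<Longrightarrow> x \<in> A \<longleftrightarrow> x \<in> {p<..<b}" for A b
  proof -
    have "(\<integral>x. indicator A x * d' x \<partial>lborel) = (\<integral>x. indicator A x * d' x \<partial>lebesgue)"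
      using d'(1) A by (intro integral_completion[symmetric] borel_measurable_times borel_measurable_indicator) auto
    also have "\<dots> = (\<integral>x. indicator {p<..<b} x * d x \<partial>lebesgue)"
    proof (rule integral_cong_AE)
      have "AE x in lebesgue. x \<noteq> p" "AE x in lebesgue. x \<noteq> q"
        by (auto intro: AE_completion[OF AE_lborel_singleton])
      with ae show "AE x in lebesgue. indicator A x * d' x = indicator {p<..<b} x * d x"
      proof eventually_elim
        case (elim x)
        then show ?case
          using Ab[of x] by (cases "x \<in> {p..q}") (auto simp: d_def indicator_def)
      qed
      show "(\<lambda>x. indicator A x * d' x) \<in> borel_measurable lebesgue"
        using d'_leb A by (intro borel_measurable_times borel_measurable_indicator) auto
      show "(\<lambda>x. indicator {p<..<b} x * d x) \<in> borel_measurable lebesgue"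
        using int_d by (intro borel_measurable_times borel_measurable_indicator) auto
    qed
    also have "\<dots> = 0"
      using zero[of b] b by (cases "p < b") auto
    finally show ?thesis .
  qed
  have "AE x in lborel. d' x = 0"
  proof (rule AE_eq_0_if_integrals_0[OF int_d'])
    show "(\<integral>x. d' x \<partial>lborel) = 0"
      using conv[of UNIV q] by auto
    show "(LINT x:{..<a}|lborel. d' x) = 0" for a
      using conv[of "{..<a}" "min a q"] by (auto simp: set_lebesgue_integral_def)
  qed
  then have "AE x in lebesgue. d' x = 0"
    by (rule AE_completion)
  with ae show ?thesis
    by eventually_elim (auto simp: d_def)
qed

text \<open>An open set is a countable union of compact intervals, to each of which the previous
  result applies.\<close>

lemma weak_deriv_unique:
  assumes g1: "is_weak_deriv k I u g1" and g2: "is_weak_deriv k I u g2" and "open I"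
  shows "AE x in lebesgue. x \<in> I \<longrightarrow> g1 x = g2 x"
proof -
  obtain \<D> where \<D>: "countable \<D>" "\<D> \<subseteq> Pow I" "\<And>X. X \<in> \<D> \<Longrightarrow> \<exists>a b. X = cbox a b" "\<Union>\<D> = I"
    using open_countable_Union_open_cbox[OF \<open>open I\<close>] by metis
  have "AE x in lebesgue. \<forall>X\<in>\<D>. x \<in> X \<longrightarrow> g1 x = g2 x"
  proof (intro AE_ball_countable'[OF _ \<D>(1)])
    fix X assume X: "X \<in> \<D>"
    then obtain a b where ab: "X = {a..b}"
      using \<D>(3) by force
    show "AE x in lebesgue. x \<in> X \<longrightarrow> g1 x = g2 x"
    proof (cases "a < b")
      case True
      then show ?thesis
        using weak_deriv_unique_on_interval[OF g1 g2 _ True] X \<D>(2) ab by auto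
    next
      \<comment> \<open>The box is empty or the single point a.\<close>
      case False
      have "AE x in lebesgue. x \<noteq> a"
        by (rule AE_completion[OF AE_lborel_singleton])
      then show ?thesis
        by eventually_elim (use False ab in auto)
    qed
  qed
  then show ?thesis
    by eventually_elim (use \<D>(4) in blast)
qed

text \<open>On a half-line the regularity hypothesis only speaks of bounded intervals (0, R).
  Uniqueness makes the derivatives on an increasing family agree almost everywhere on overlaps, and
  every compact set lies in a single member, so one member suffices for each integral.\<close>

lemma weak_deriv_glue:
  assumes wd: "\<And>n. is_weak_deriv k (I n) u (g n)" and op: "\<And>n. open (I n)" and inc: "incseq I"
  shows "\<exists>g'. is_weak_deriv k (\<Union>n. I n) u g'"
proof -
  \<comment> \<open>At each point the first available derivative is used; later ones agree with it
    almost everywhere.\<close>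
  define g' where "g' x = g (LEAST n. x \<in> I n) x" for x
  have "AE x in lebesgue. x \<in> I m \<longrightarrow> g m x = g n x" if "m \<le> n" for m n
    using weak_deriv_unique[OF wd weak_deriv_subset[OF wd] op] inc that by (auto simp: incseq_def)
  then have "AE x in lebesgue. \<forall>m n. m \<le> n \<longrightarrow> x \<in> I m \<longrightarrow> g m x = g n x"
    unfolding AE_all_countable by (auto intro: AE_impI)
  then have ae: "AE x in lebesgue. \<forall>n. x \<in> I n \<longrightarrow> g' x = g n x"
    unfolding g'_def by eventually_elim (metis LeastI Least_le)
  have cover: "\<exists>n. K \<subseteq> I n" if K: "compact K" "K \<subseteq> (\<Union>n. I n)" for K
  proof -
    obtain N where "finite N" "K \<subseteq> (\<Union>n\<in>N. I n)"
      using compactE_image[OF K(1), of UNIV I] op K(2) by auto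
    moreover have "(\<Union>n\<in>N. I n) \<subseteq> I (Max N)"
      using \<open>finite N\<close> inc by (intro UN_least) (simp add: incseq_def)
    ultimately show ?thesis by blast
  qed
  have "is_weak_deriv k (\<Union>n. I n) u g'"
    unfolding is_weak_deriv_def
  proof (intro conjI allI impI)
    show "loc_integrable (\<Union>n. I n) u"
      using wd cover unfolding loc_integrable_def is_weak_deriv_def by meson
    show "loc_integrable (\<Union>n. I n) g'"
      unfolding loc_integrable_def
    proof (intro allI impI)
      fix K :: "real set" assume K: "compact K" "K \<subseteq> (\<Union>n. I n)"
      then obtain n where n: "K \<subseteq> I n"
        using cover by blast
      have int: "set_integrable lebesgue K (g n)"
        using wd K(1) n by (auto simp: loc_integrable_def is_weak_deriv_def)
      obtain N where N: "{x. \<not> (\<forall>n. x \<in> I n \<longrightarrow> g' x = g n x)} \<subseteq> N" "N \<in> null_sets lebesgue"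
        using ae by (auto elim!: AE_E simp: null_sets_def)
      show "set_integrable lebesgue K g'"
        by (rule absolutely_integrable_spike[OF int, of N])
          (use N n in \<open>auto simp: negligible_iff_null_sets\<close>)
    qed
    fix \<psi> assume \<psi>: "test_function (\<Union>n. I n) \<psi>"
    then obtain K where K: "compact K" "K \<subseteq> (\<Union>n. I n)" "\<And>x. x \<notin> K \<Longrightarrow> \<psi> x = 0"
      by (auto simp: test_function_iff)
    then obtain n where n: "K \<subseteq> I n"
      using cover by blast
    then have "test_function (I n) \<psi>"
      using \<psi> K by (auto simp: test_function_iff)
    then have "(LINT x:I n|lebesgue. u x * (deriv ^^ k) \<psi> x) = (-1) ^ k * (LINT x:I n|lebesgue. g n x * \<psi> x)"
      using wd by (simp add: is_weak_deriv_def)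
    moreover have "(LINT x:I n|lebesgue. u x * (deriv ^^ k) \<psi> x) = (LINT x:(\<Union>n. I n)|lebesgue. u x * (deriv ^^ k) \<psi> x)"
    proof -
      have "u x * (deriv ^^ k) \<psi> x = 0" if "x \<notin> K" for x
        using deriv_pow_0_outside[OF compact_imp_closed[OF K(1)] K(3) that] by simp
      then show ?thesis
        using n K(2) by (subst (1 2) integral_indicator_support) auto
    qed
    moreover have "(LINT x:I n|lebesgue. g n x * \<psi> x) = (LINT x:(\<Union>n. I n)|lebesgue. g' x * \<psi> x)"
    proof -
      have "(LINT x:I n|lebesgue. g n x * \<psi> x) = (\<integral>x. g n x * \<psi> x \<partial>lebesgue)"
        using n K(3) by (intro integral_indicator_support) auto
      also have "\<dots> = (\<integral>x. g' x * \<psi> x \<partial>lebesgue)"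
      proof -
        have int: "integrable lebesgue (\<lambda>x. g n x * \<psi> x)"
          using \<open>test_function (I n) \<psi>\<close> wd by (auto intro: integrable_mult_test_function simp: is_weak_deriv_def)
        have "integrable lebesgue (\<lambda>x. g' x * \<psi> x)"
          using \<psi> \<open>loc_integrable (\<Union>n. I n) g'\<close> by (auto intro: integrable_mult_test_function)
        with int show ?thesis
        proof (intro integral_cong_AE)
          show "AE x in lebesgue. g n x * \<psi> x = g' x * \<psi> x"
            using ae by eventually_elim (use n K(3) in \<open>metis mult_zero_right subsetD\<close>)
        qed auto
      qed
      also have "\<dots> = (LINT x:(\<Union>n. I n)|lebesgue. g' x * \<psi> x)"
        using K(2,3) by (intro integral_indicator_support[symmetric]) (metis mult_zero_right subsetD)
      finally show ?thesis .
    qed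
    ultimately show "(LINT x:(\<Union>n. I n)|lebesgue. u x * (deriv ^^ k) \<psi> x) = (-1) ^ k * (LINT x:(\<Union>n. I n)|lebesgue. g' x * \<psi> x)"
      by simp
  qed
  then show ?thesis by blast
qed

text \<open>The zero function is also a weak second derivative, since \<psi>'' integrates to the
  difference of \<psi>' at two points outside the support. Uniqueness then applies.\<close>

lemma weak_second_deriv_const:
  assumes wd: "is_weak_deriv 2 I u g" and u: "\<And>x. x \<in> I \<Longrightarrow> u x = C" and "open I"
  shows "AE x in lebesgue. x \<in> I \<longrightarrow> g x = 0"
proof -
  have "is_weak_deriv 2 I u (\<lambda>x. 0)"
    unfolding is_weak_deriv_def
  proof (intro conjI allI impI)
    show "loc_integrable I u"
      using wd by (simp add: is_weak_deriv_def)
    show "loc_integrable I (\<lambda>x. 0)"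
      by (simp add: loc_integrable_def set_integrable_def)
    fix \<psi> assume "test_function I \<psi>"
    then obtain K where K: "compact K" "K \<subseteq> I" "\<And>x. x \<notin> K \<Longrightarrow> \<psi> x = 0" and \<psi>: "smooth \<psi>"
      by (auto simp: test_function_iff)
    have out: "(deriv ^^ k) \<psi> x = 0" if "x \<notin> K" for x k
      using deriv_pow_0_outside[OF compact_imp_closed[OF K(1)] K(3) that] .
    obtain B where "0 < B" "\<And>x. x \<in> K \<Longrightarrow> \<bar>x\<bar> < B"
      using compact_imp_bounded[OF K(1)] unfolding bounded_pos_less by auto
    then have B: "K \<subseteq> {-B<..<B}" "0 < B"
      by (auto simp: abs_less_iff minus_less_iff)
    have "(LINT x:I|lebesgue. u x * (deriv ^^ 2) \<psi> x) = (\<integral>x. u x * (deriv ^^ 2) \<psi> x \<partial>lebesgue)"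
      using out K(2) by (intro integral_indicator_support) auto
    also have "\<dots> = (\<integral>x. C * ((deriv ^^ 2) \<psi> x * indicator {-B..B} x) \<partial>lebesgue)"
    proof (rule Bochner_Integration.integral_cong[OF refl])
      fix x
      show "u x * (deriv ^^ 2) \<psi> x = C * ((deriv ^^ 2) \<psi> x * indicator {-B..B} x)"
        using out[of x 2] u[of x] K(2) B(1) by (cases "x \<in> K") (auto simp: indicator_def subset_eq)
    qed
    also have "\<dots> = (\<integral>x. C * ((deriv ^^ 2) \<psi> x * indicator {-B..B} x) \<partial>lborel)"
      using smooth_continuous[OF smooth_deriv[OF smooth_deriv[OF \<psi>]], of UNIV]
      by (intro integral_completion borel_measurable_times borel_measurable_indicator)
        (auto simp: numeral_2_eq_2 intro!: borel_measurable_continuous_onI)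
    also have "\<dots> = C * (deriv \<psi> B - deriv \<psi> (- B))"
      using smooth_continuous[OF smooth_deriv[OF smooth_deriv[OF \<psi>]], of UNIV] B(2)
      by (subst integral_mult_right_zero, subst integral_FTC_Icc_real[where F = "deriv \<psi>"])
        (auto simp: numeral_2_eq_2 continuous_on_eq_continuous_at intro!: smooth_has_deriv smooth_deriv \<psi>)
    also have "B \<notin> K" "- B \<notin> K"
      using B by auto
    then have "C * (deriv \<psi> B - deriv \<psi> (- B)) = 0"
      using out[of B 1] out[of "-B" 1] by simp
    finally show "(LINT x:I|lebesgue. u x * (deriv ^^ 2) \<psi> x) = (-1) ^ 2 * (LINT x:I|lebesgue. 0 * \<psi> x)"
      by (simp add: set_lebesgue_integral_def)
  qed
  from weak_deriv_unique[OF wd this \<open>open I\<close>] show ?thesis .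
qed

subsection \<open>Concave functions on an edge\<close>

text \<open>Clearing denominators keeps degenerate triples valid and reduces later uses of concavity
  to linear arithmetic.\<close>

lemma concave_on_three_points:
  fixes f :: "real \<Rightarrow> real"
  assumes "concave_on S f" "x \<in> S" "z \<in> S" "x \<le> y" "y \<le> z"
  shows "(z - y) * f x + (y - x) * f z \<le> (z - x) * f y"
proof (cases "x = z")
  case False
  then have "x < z" using assms by simp
  define t where "t = (y - x) / (z - x)"
  have t: "0 \<le> t" "t \<le> 1" "t * (z - x) = y - x"
    using assms \<open>x < z\<close> by (auto simp: t_def)
  then have t': "(1 - t) * x + t * z = y" "(1 - t) * (z - x) = z - y"
    by (simp_all add: algebra_simps)
  have "(1 - t) * f x + t * f z \<le> f y"
    using concave_onD[OF assms(1) t(1,2) assms(2,3)] t'(1) by simp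
  then have "((1 - t) * f x + t * f z) * (z - x) \<le> f y * (z - x)"
    using \<open>x < z\<close> by (intro mult_right_mono) auto
  also have "((1 - t) * f x + t * f z) * (z - x) = ((1 - t) * (z - x)) * f x + (t * (z - x)) * f z"
    by (simp add: algebra_simps)
  finally show ?thesis
    unfolding t(3) t'(2) by (simp add: mult_ac)
qed (use assms in auto)

text \<open>Subtract the chord. If the difference d were negative somewhere, then at its leftmost
  minimum d would be no smaller on the right and strictly larger on the left, so its second
  difference would be positive. The chord contributes nothing to second differences, a
  contradiction.\<close>

lemma concave_on_if_local_second_difference:
  fixes f :: "real \<Rightarrow> real"
  assumes "convex S" and cont: "continuous_on S f"
    and between: "\<And>x y z. x \<in> S \<Longrightarrow> y \<in> S \<Longrightarrow> x < z \<Longrightarrow> z < y \<Longrightarrow> z \<in> I"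
    and loc: "\<And>x. x \<in> I \<Longrightarrow> \<exists>\<delta>>0. \<forall>h. 0 < h \<and> h < \<delta> \<longrightarrow> f (x + h) + f (x - h) - 2 * f x \<le> 0"
  shows "concave_on S f"
proof (rule concave_on_linorderI)
  fix t x y :: real
  assume t: "0 < t" "t < 1" and xy: "x \<in> S" "y \<in> S" "x < y"
  define c where "c = (f y - f x) / (y - x)"
  define l where "l s = f x + c * (s - x)" for s
  define d where "d s = f s - l s" for s
  have xyS: "{x..y} \<subseteq> S"
    using xy \<open>convex S\<close> by (metis convex_contains_segment closed_segment_eq_real_ivl less_imp_le)
  have cont_d: "continuous_on {x..y} d"
    unfolding d_def[abs_def] l_def[abs_def]
    by (intro continuous_intros continuous_on_subset[OF cont xyS])
  have ends: "d x = 0" "d y = 0"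
    using xy by (auto simp: d_def l_def c_def)
  obtain s0 where s0: "s0 \<in> {x..y}" "\<And>s. s \<in> {x..y} \<Longrightarrow> d s0 \<le> d s"
    using continuous_attains_inf[OF compact_Icc _ cont_d] xy(3) by auto
  have "0 \<le> d s0"
  proof (rule ccontr)
    assume neg: "\<not> 0 \<le> d s0"
    \<comment> \<open>The set of minimisers is compact and so has a least element. Leftmost choice
      yields the strict inequality that the weak hypothesis does not provide.\<close>
    define Z where "Z = {s \<in> {x..y}. d s \<le> d s0}"
    have "compact Z"
    proof -
      have "closed Z"
        unfolding Z_def using continuous_closed_preimage[OF cont_d closed_atLeastAtMost, of "{..d s0}"]
        by (simp add: vimage_def Int_def)
      moreover have "Z \<subseteq> {x..y}" by (auto simp: Z_def)
      ultimately show ?thesis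
        using compact_Icc closed_subset compact_Int_closed[of "{x..y}" Z] by (simp add: Int_absorb1)
    qed
    moreover have "Z \<noteq> {}"
      using s0(1) by (auto simp: Z_def)
    ultimately obtain s where s: "s \<in> Z" "\<And>r. r \<in> Z \<Longrightarrow> s \<le> r"
      using compact_attains_inf[of Z] by metis
    have sI: "s \<in> {x..y}" and "d s \<le> d s0"
      using s(1) by (auto simp: Z_def)
    then have ds: "d s = d s0"
      using s0(2) by (meson antisym)
    then have "s \<noteq> x" "s \<noteq> y"
      using neg ends by auto
    then have sxy: "x < s" "s < y"
      using sI by auto
    obtain \<delta> where \<delta>: "\<delta> > 0" "\<And>h. 0 < h \<Longrightarrow> h < \<delta> \<Longrightarrow> f (s + h) + f (s - h) - 2 * f s \<le> 0"
      using loc between[OF xy(1,2) sxy] by blast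
    \<comment> \<open>Small enough for the local hypothesis and for both neighbours of s to stay in
      [x, y].\<close>
    define h where "h = min (\<delta> / 2) (min (s - x) (y - s))"
    have h: "0 < h" "h < \<delta>" "x \<le> s - h" "s + h \<le> y"
      using \<delta>(1) sxy by (auto simp: h_def min_def)
    have "d s0 \<le> d (s + h)"
      using h sxy by (intro s0(2)) auto
    moreover have "d s0 < d (s - h)"
    proof (rule ccontr)
      assume "\<not> d s0 < d (s - h)"
      then have "s - h \<in> Z"
        using h sxy by (auto simp: Z_def)
      then show False
        using s(2) h(1) by fastforce
    qed
    moreover have "d (s + h) + d (s - h) - 2 * d s = f (s + h) + f (s - h) - 2 * f s"
      by (simp add: d_def l_def algebra_simps)
    ultimately show False
      using \<delta>(2)[OF h(1,2)] ds by linarith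
  qed
  moreover have mid: "(1 - t) * x + t * y \<in> {x..y}"
  proof -
    have "(1 - t) * x + t * y = x + t * (y - x)" "(1 - t) * x + t * y = y - (1 - t) * (y - x)"
      by (simp_all add: algebra_simps)
    moreover have "0 \<le> t * (y - x)" "0 \<le> (1 - t) * (y - x)"
      using t xy(3) by simp_all
    ultimately show ?thesis
      unfolding atLeastAtMost_iff by linarith
  qed
  ultimately have "0 \<le> d ((1 - t) * x + t * y)"
    using s0(2) by (meson order_trans)
  moreover have "l ((1 - t) * x + t * y) = (1 - t) * f x + t * f y"
  proof -
    have "(1 - t) * x + t * y - x = t * (y - x)"
      by (simp add: algebra_simps)
    moreover have "c * (y - x) = f y - f x"
      using xy(3) by (simp add: c_def)
    ultimately have "c * ((1 - t) * x + t * y - x) = t * (f y - f x)"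
      by (simp add: mult.left_commute)
    then show ?thesis
      by (simp add: l_def algebra_simps)
  qed
  ultimately show "(1 - t) * f x + t * f y \<le> f ((1 - t) *\<^sub>R x + t *\<^sub>R y)"
    by (simp add: d_def)
qed fact

text \<open>Truncating at \<open>0\<close> removes the sign condition: a point where \<open>u \<ge> 0\<close> is a maximum of
  \<open>min (u x) 0\<close>.\<close>

lemma concave_on_min_0_if_weak_deriv_nonpos:
  assumes wd: "is_weak_deriv 2 I u g" and "open I" "I \<subseteq> S" "convex S" and cont: "continuous_on S u"
    and between: "\<And>x y z. x \<in> S \<Longrightarrow> y \<in> S \<Longrightarrow> x < z \<Longrightarrow> z < y \<Longrightarrow> z \<in> I"
    and ae: "AE x in lebesgue. x \<in> I \<longrightarrow> u x < 0 \<longrightarrow> g x \<le> 0"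
  shows "concave_on S (\<lambda>x. min (u x) 0)"
proof (rule concave_on_if_local_second_difference[OF \<open>convex S\<close>, where I = I])
  show "continuous_on S (\<lambda>x. min (u x) 0)"
    by (intro continuous_intros cont)
  fix x assume x: "x \<in> I"
  show "\<exists>\<delta>>0. \<forall>h. 0 < h \<and> h < \<delta> \<longrightarrow> min (u (x + h)) 0 + min (u (x - h)) 0 - 2 * min (u x) 0 \<le> 0"
  proof (cases "u x < 0")
    case True
    have contI: "continuous_on I u"
      using cont \<open>I \<subseteq> S\<close> by (rule continuous_on_subset)
    \<comment> \<open>Near a point with u < 0 the bound on g holds almost everywhere, and the second
      difference estimate is used with c = 0.\<close>
    have "open (I \<inter> u -` {..<0})"
      using contI \<open>open I\<close> by (intro continuous_open_preimage) auto
    moreover have "x \<in> I \<inter> u -` {..<0}"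
      using x True by simp
    ultimately obtain e where e: "e > 0" "cball x e \<subseteq> I \<inter> u -` {..<0}"
      by (metis open_contains_cball)
    then have sub: "{x - e..x + e} \<subseteq> I" "\<And>y. y \<in> {x - e..x + e} \<Longrightarrow> u y < 0"
      by (auto simp: cball_eq_atLeastAtMost subset_eq)
    have "AE y in lebesgue. y \<in> {x - e..x + e} \<longrightarrow> g y \<le> 0"
      using ae by eventually_elim (use sub in blast)
    then have "u (x + h) + u (x - h) - 2 * u x \<le> 2 * 0 * h\<^sup>2" if "0 < h" "h < e" for h
      using that by (intro weak_second_difference_le[OF wd continuous_on_subset[OF contI sub(1)] sub(1)]) auto
    then show ?thesis
      using sub(2) e(1) by (intro exI[of _ e]) (auto simp: min_absorb1 less_imp_le)
  next
    case False
    then show ?thesis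
      by (intro exI[of _ 1]) auto
  qed
qed (rule between)

lemma concave_on_ge_min_ends:
  fixes f :: "real \<Rightarrow> real"
  assumes "concave_on {a..b} f" "x \<in> {a..b}"
  shows "min (f a) (f b) \<le> f x"
proof (cases "a = b")
  case False
  then have "a < b" using assms(2) by simp
  have "(b - x) * min (f a) (f b) + (x - a) * min (f a) (f b) \<le> (b - x) * f a + (x - a) * f b"
    using assms(2) by (intro add_mono mult_left_mono) auto
  also have "\<dots> \<le> (b - a) * f x"
    using assms(2) by (intro concave_on_three_points[OF assms(1)]) auto
  finally have "(b - a) * min (f a) (f b) \<le> (b - a) * f x"
    by (simp add: algebra_simps)
  with \<open>a < b\<close> show ?thesis by simp
qed (use assms in auto)

text \<open>If f falls below f 0 at some x, the chord from 0 to x has negative slope, and beyond x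
  concavity keeps f below that line.\<close>

lemma concave_on_halfline_dichotomy:
  fixes f :: "real \<Rightarrow> real"
  assumes f: "concave_on {0..} f"
  shows "(\<forall>x\<ge>0. f 0 \<le> f x) \<or> filterlim f at_bot at_top"
proof (cases "\<forall>x\<ge>0. f 0 \<le> f x")
  case False
  then obtain x where x: "x \<ge> 0" "f x < f 0" by force
  then have "x > 0" by (metis less_irrefl order.order_iff_strict)
  define c where "c = (f x - f 0) / x"
  have "c < 0"
    using x \<open>x > 0\<close> by (simp add: c_def divide_neg_pos)
  have "f z \<le> f 0 + c * z" if "x \<le> z" for z
  proof -
    have "(z - x) * f 0 + (x - 0) * f z \<le> (z - 0) * f x"
      using that x by (intro concave_on_three_points[OF f]) auto
    then show ?thesis
      using \<open>x > 0\<close> by (simp add: c_def field_simps)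
  qed
  then have "f z \<le> Z" if "max x ((Z - f 0) / c) \<le> z" for z Z
    using that \<open>c < 0\<close> by (force simp: neg_divide_le_eq mult.commute)
  then have "filterlim f at_bot at_top"
    unfolding filterlim_at_bot by (blast intro: eventually_at_top_linorderI)
  then show ?thesis ..
qed blast

text \<open>Given y on one side of x, the chord to a point on the other side passes at or below f x
  at x. Since that far value is at least f x, f y cannot exceed f x.\<close>

lemma concave_on_interior_min_imp_const:
  fixes f :: "real \<Rightarrow> real"
  assumes f: "concave_on S f" and min: "\<And>y. y \<in> S \<Longrightarrow> f x \<le> f y"
    and p: "p \<in> S" "p < x" and q: "q \<in> S" "x < q" and y: "y \<in> S"
  shows "f y = f x"
proof (rule antisym[OF _ min[OF y]])
  consider "y = x" | "y < x" | "x < y" by linarith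
  then show "f y \<le> f x"
  proof cases
    case 2
    have "(q - x) * f y + (x - y) * f x \<le> (q - x) * f y + (x - y) * f q"
      using 2 min[OF q(1)] by (intro add_left_mono mult_left_mono) auto
    also have "\<dots> \<le> (q - y) * f x"
      using 2 q y by (intro concave_on_three_points[OF f]) auto
    finally have "(q - x) * f y \<le> (q - x) * f x"
      by (simp add: algebra_simps)
    with q show ?thesis by simp
  next
    case 3
    have "(y - x) * f x + (x - p) * f y \<le> (y - x) * f p + (x - p) * f y"
      using 3 min[OF p(1)] by (intro add_right_mono mult_left_mono) auto
    also have "\<dots> \<le> (y - p) * f x"
      using 3 p y by (intro concave_on_three_points[OF f]) auto
    finally have "(x - p) * f y \<le> (x - p) * f x"
      by (simp add: algebra_simps)
    with p show ?thesis by simp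
  qed simp
qed

text \<open>Concavity makes the difference quotients at \<open>0\<close> monotone, and the lower bound on the second
  differences keeps them bounded, so that they converge.\<close>

lemma right_derivative_at_min:
  fixes u :: "real \<Rightarrow> real"
  assumes conc: "concave_on S (\<lambda>x. min (u x) 0)" and "0 < L" "{0..L} \<subseteq> S" "S \<subseteq> {0..}"
    and cont: "continuous_on {0..L} u"
    and second: "\<And>a h. 0 < h \<Longrightarrow> 0 < a - h \<Longrightarrow> a + h < L \<Longrightarrow> - (2 * M * h\<^sup>2) \<le> u (a + h) + u (a - h) - 2 * u a"
    and "u 0 < 0" and min: "\<And>x. x \<in> S \<Longrightarrow> u 0 \<le> u x" and "0 \<le> M"
  shows "\<exists>D\<ge>0. (u has_real_derivative D) (at_right 0) \<and>
    (D = 0 \<longrightarrow> (\<forall>x\<in>S. u x = u 0))"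
proof -
  \<comment> \<open>On [0, l] the truncation is inactive, so u itself is concave there.\<close>
  obtain l where l: "0 < l" "l \<le> L" "\<And>x. x \<in> {0..l} \<Longrightarrow> u x < 0"
  proof -
    have "\<exists>d>0. \<forall>x\<in>{0..L}. dist x 0 < d \<longrightarrow> dist (u x) (u 0) < - u 0"
      using cont[unfolded continuous_on_iff, rule_format, of 0 "- u 0"] \<open>u 0 < 0\<close> \<open>0 < L\<close> by simp
    then obtain d where d: "d > 0" "\<And>x. x \<in> {0..L} \<Longrightarrow> \<bar>x\<bar> < d \<Longrightarrow> \<bar>u x - u 0\<bar> < - u 0"
      by (auto simp: dist_real_def)
    show thesis
    proof (rule that[of "min L (d / 2)"])
      fix x assume "x \<in> {0..min L (d / 2)}"
      then have "\<bar>u x - u 0\<bar> < - u 0"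
        using d(1) by (intro d(2)) auto
      then show "u x < 0" by linarith
    qed (use d(1) \<open>0 < L\<close> in auto)
  qed
  have lS: "{0..l} \<subseteq> S"
    using l assms(3) by auto
  have conc_u: "(z - y) * u x + (y - x) * u z \<le> (z - x) * u y" if "0 \<le> x" "x \<le> y" "y \<le> z" "z \<le> l" for x y z
    using concave_on_three_points[OF conc, of x z y] that lS l(3)[of x] l(3)[of y] l(3)[of z]
    by (auto simp: subset_eq min_absorb1 less_imp_le)
  define s where "s x = (u x - u 0) / x" for x
  have anti: "s y \<le> s x" if "0 < x" "x \<le> y" "y \<le> l" for x y
    using conc_u[of 0 x y] that by (simp add: s_def field_simps)
  \<comment> \<open>The term \<open>M * x\<^sup>2\<close> has second difference
    \<open>2 * M * h\<^sup>2\<close>, which compensates the lower bound for u and makes the sum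
    convex. Convexity then bounds the slopes \<open>s\<close> from above.\<close>
  have "concave_on {0..l} (\<lambda>x. - (u x + M * x\<^sup>2))"
  proof (rule concave_on_if_local_second_difference[where I = "{0<..<l}"])
    show "continuous_on {0..l} (\<lambda>x. - (u x + M * x\<^sup>2))"
      using l by (intro continuous_intros continuous_on_subset[OF cont]) auto
    fix x assume x: "x \<in> {0<..<l}"
    have "- (u (x + h) + M * (x + h)\<^sup>2) + - (u (x - h) + M * (x - h)\<^sup>2) - 2 * - (u x + M * x\<^sup>2) \<le> 0"
      if "0 < h" "h < min x (l - x)" for h
      using second[of h x] that l(2) by (simp add: power2_eq_square algebra_simps)
    then show "\<exists>\<delta>>0. \<forall>h. 0 < h \<and> h < \<delta> \<longrightarrow>
       - (u (x + h) + M * (x + h)\<^sup>2) + - (u (x - h) + M * (x - h)\<^sup>2) - 2 * - (u x + M * x\<^sup>2) \<le> 0"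
      using x by (intro exI[of _ "min x (l - x)"]) auto
  qed auto
  then have conv: "s x \<le> s l + M * l" if x: "0 < x" "x \<le> l" for x
  proof -
    have "(l - x) * - (u 0 + M * 0\<^sup>2) + (x - 0) * - (u l + M * l\<^sup>2) \<le> (l - 0) * - (u x + M * x\<^sup>2)"
      using concave_on_three_points[OF \<open>concave_on {0..l} _\<close>, of 0 l x] x by auto
    then have "l * (u x - u 0) + l * (M * x\<^sup>2) \<le> x * (u l - u 0) + x * (M * l\<^sup>2)"
      by (simp add: algebra_simps)
    moreover have "0 \<le> l * (M * x\<^sup>2)"
      using l(1) \<open>0 \<le> M\<close> by simp
    ultimately have "l * (u x - u 0) \<le> x * (u l - u 0) + x * (M * l\<^sup>2)"
      by linarith
    then show ?thesis
      using x l(1) by (simp add: s_def field_simps power2_eq_square)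
  qed
  \<comment> \<open>As the slopes increase towards 0, their supremum is their limit.\<close>
  define D where "D = (SUP x\<in>{0<..l}. s x)"
  have bdd: "bdd_above (s ` {0<..l})"
    using conv by (auto intro!: bdd_aboveI2)
  have le_D: "s x \<le> D" if "0 < x" "x \<le> l" for x
    unfolding D_def using that bdd by (intro cSUP_upper) auto
  have "(s \<longlongrightarrow> D) (at_right 0)"
  proof (rule order_tendstoI)
    fix y assume "y < D"
    then obtain x where x: "0 < x" "x \<le> l" "y < s x"
      unfolding D_def using less_cSUP_iff[OF _ bdd] l(1) by auto
    show "\<forall>\<^sub>F z in at_right 0. y < s z"
      unfolding eventually_at_right_field using anti x by (intro exI[of _ x]) (meson less_le_trans less_imp_le)
  next
    fix y assume "D < y"
    then show "\<forall>\<^sub>F z in at_right 0. s z < y"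
      unfolding eventually_at_right_field using le_D l(1) by (intro exI[of _ l]) (meson le_less_trans less_imp_le)
  qed
  then have "(u has_real_derivative D) (at_right 0)"
    by (simp add: has_field_derivative_iff s_def[abs_def])
  moreover have "0 \<le> D"
  proof -
    have "u 0 \<le> u l"
      using l(1) lS by (intro min) auto
    then have "0 \<le> s l"
      using l(1) by (simp add: s_def)
    then show ?thesis
      using le_D[of l] l(1) by simp
  qed
  moreover have "u x = u 0" if "D = 0" "x \<in> S" for x
  proof -
    have eq: "u y = u 0" if y: "0 \<le> y" "y \<le> l" for y
    proof (cases "y = 0")
      case False
      then have "s y \<le> 0"
        using le_D[of y] y \<open>D = 0\<close> by simp
      then have "u y \<le> u 0"
        using y False by (simp add: s_def divide_le_0_iff)
      moreover have "u 0 \<le> u y"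
        using y lS by (intro min) auto
      ultimately show ?thesis by simp
    qed simp
    show ?thesis
    proof (cases "x \<le> l")
      case False
      \<comment> \<open>Beyond l the untruncated u need not be concave, so the argument continues
        with the truncation: already constant on [0, l], it cannot rise afterwards.\<close>
      have "(x - l) * min (u 0) 0 + (l - 0) * min (u x) 0 \<le> (x - 0) * min (u l) 0"
        using False l(1) lS \<open>x \<in> S\<close> by (intro concave_on_three_points[OF conc]) auto
      then have "l * min (u x) 0 \<le> l * u 0"
        using eq[of l] l(1) \<open>u 0 < 0\<close> by (simp add: min_absorb1 algebra_simps)
      then have "min (u x) 0 \<le> u 0"
        using l(1) by simp
      then have "u x \<le> u 0"
        using \<open>u 0 < 0\<close> by (auto simp: min_def split: if_splits)
      then show ?thesis
        using min[OF \<open>x \<in> S\<close>] by simp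
    qed (use eq \<open>S \<subseteq> {0..}\<close> \<open>x \<in> S\<close> in auto)
  qed
  ultimately show ?thesis by blast
qed

subsection \<open>Edges of a metric graph\<close>

lemma edge_cases [consumes 1, case_names bounded halfline]:
  assumes "0 < len G e"
  obtains L where "0 < L" "len G e = ereal L" "edge_dom G e = {0..L}" "edge_interior G e = {0<..<L}"
  | "len G e = \<infinity>" "edge_dom G e = {0..}" "edge_interior G e = {0<..}"
proof (cases "len G e")
  case (real L)
  with assms show ?thesis
    by (intro that(1)[of L]) (auto simp: edge_dom_def edge_interior_def)
next
  case PInf
  then show ?thesis
    by (intro that(2)) (auto simp: edge_dom_def edge_interior_def)
qed (use assms in simp)

lemma edge_geometry:
  assumes "0 < len G e"
  shows open_edge_interior: "open (edge_interior G e)"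
    and edge_interior_subset: "edge_interior G e \<subseteq> edge_dom G e"
    and convex_edge_dom: "convex (edge_dom G e)"
    and edge_interior_between: "\<And>x y z. x \<in> edge_dom G e \<Longrightarrow> y \<in> edge_dom G e \<Longrightarrow> x < z \<Longrightarrow> z < y \<Longrightarrow> z \<in> edge_interior G e"
  using assms by (cases rule: edge_cases; auto)+

text \<open>Openness in the graph is defined through preimages under the edge parametrisations, so
  these are continuous.\<close>

lemma continuous_on_on_edge:
  assumes \<phi>: "continuous_map (graph_topology G) euclideanreal \<phi>" and e: "e \<in> edges G"
  shows "continuous_on (edge_dom G e) (on_edge G e \<phi>)"
proof -
  have "continuous_map (top_of_set (edge_dom G e)) (graph_topology G) (edge_point G e)"
    unfolding continuous_map_def topspace_graph_topology openin_graph_topology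
  proof (intro conjI allI impI)
    show "edge_point G e \<in> topspace (top_of_set (edge_dom G e)) \<rightarrow> points G"
      using e by (auto simp: points_def)
  qed (use e in simp)
  from continuous_map_compose[OF this \<phi>] show ?thesis
    by (simp add: on_edge_def[abs_def] comp_def)
qed

lemma weak_deriv_minus:
  assumes "is_weak_deriv k I u g"
  shows "is_weak_deriv k I (\<lambda>x. - u x) (\<lambda>x. - g x)"
  using assms by (simp add: is_weak_deriv_def loc_integrable_def set_integrable_def set_lebesgue_integral_def)

lemma sobolev_infD:
  assumes "u \<in> sobolev_inf k I" "1 \<le> j" "j \<le> k"
  shows "\<exists>g\<in>Linf I. is_weak_deriv j I u g"
  using assms by (simp add: sobolev_inf_def)

text \<open>The upper estimate is applied to -u, with the essential bound of the weak second
  derivative made nonnegative by \<open>max M 0\<close>.\<close>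

lemma second_difference_ge:
  assumes u: "u \<in> sobolev_inf 2 {0<..<L}" and cont: "continuous_on {0..L} u"
  shows "\<exists>M\<ge>0. \<forall>a h. 0 < h \<longrightarrow> 0 < a - h \<longrightarrow> a + h < L \<longrightarrow>
    - (2 * M * h\<^sup>2) \<le> u (a + h) + u (a - h) - 2 * u a"
proof -
  obtain g where g: "g \<in> Linf {0<..<L}" "is_weak_deriv 2 {0<..<L} u g"
    using sobolev_infD[OF u, of 2] by auto
  obtain M where M: "AE x\<in>{0<..<L} in lebesgue. \<bar>g x\<bar> \<le> M"
    using g(1) unfolding Linf_def by blast
  have "- (2 * max M 0 * h\<^sup>2) \<le> u (a + h) + u (a - h) - 2 * u a" if ah: "0 < h" "0 < a - h" "a + h < L" for a h
  proof -
    obtain p where p: "0 < p" "p < a - h" using dense[OF ah(2)] by blast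
    obtain q where q: "a + h < q" "q < L" using dense[OF ah(3)] by blast
    have "- u (a + h) + - u (a - h) - 2 * - u a \<le> 2 * max M 0 * h\<^sup>2"
    proof (rule weak_second_difference_le[OF weak_deriv_minus[OF g(2)], of p q])
      show "continuous_on {p..q} (\<lambda>x. - u x)"
        using p q by (intro continuous_intros continuous_on_subset[OF cont]) auto
      show "AE x in lebesgue. x \<in> {p..q} \<longrightarrow> - g x \<le> max M 0"
        using M by eventually_elim (use p q in auto)
    qed (use that p q in auto)
    then show ?thesis by simp
  qed
  then show ?thesis
    by (intro exI[of _ "max M 0"]) auto
qed

text \<open>\<open>weak_deriv\<close> is a choice, meaningful once some weak derivative exists on
  the whole open edge; on a half-line one is glued together from (0, n + 1).\<close>

lemma is_weak_deriv_edge: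
  assumes "0 < len G e" "u \<in> W2inf_loc_edge G e"
  shows "is_weak_deriv 2 (edge_interior G e) u (weak_deriv 2 (edge_interior G e) u)"
proof -
  have "\<exists>g. is_weak_deriv 2 (edge_interior G e) u g"
    using assms(1)
  proof (cases rule: edge_cases)
    case (bounded L)
    then have "u \<in> sobolev_inf 2 (edge_interior G e)"
      using assms(2) by (simp add: W2inf_loc_edge_def)
    from sobolev_infD[OF this, of 2] show ?thesis by auto
  next
    case halfline
    have "\<exists>g. is_weak_deriv 2 {0<..<real (Suc n)} u g" for n
    proof -
      have "u \<in> sobolev_inf 2 {0<..<real (Suc n)}"
        using assms(2) halfline by (simp add: W2inf_loc_edge_def)
      from sobolev_infD[OF this, of 2] show ?thesis by auto
    qed
    then obtain g where "\<And>n. is_weak_deriv 2 {0<..<real (Suc n)} u (g n)"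
      by metis
    then have "\<exists>g'. is_weak_deriv 2 (\<Union>n. {0<..<real (Suc n)}) u g'"
      by (rule weak_deriv_glue) (auto simp: incseq_def)
    moreover have "(\<Union>n. {0<..<real (Suc n)}) = {0<..}"
    proof -
      have "\<exists>n. x < real (Suc n)" for x :: real
        using reals_Archimedean2[of x] by (metis lessI less_trans of_nat_less_iff)
      then show ?thesis
        by (auto simp del: of_nat_Suc)
    qed
    ultimately show ?thesis
      using halfline by simp
  qed
  then show ?thesis
    unfolding weak_deriv_def by (rule someI_ex)
qed

text \<open>Only an initial segment matters for the one-sided derivative, which treats bounded edges
  and half-lines alike.\<close>

lemma derivative_at_src_if_min:
  assumes pos: "0 < len G e" and cont: "continuous_on (edge_dom G e) u" and W2: "u \<in> W2inf_loc_edge G e"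
    and conc: "concave_on (edge_dom G e) (\<lambda>x. min (u x) 0)"
    and "u 0 < 0" and min: "\<And>x. x \<in> edge_dom G e \<Longrightarrow> u 0 \<le> u x"
  shows "0 \<le> vector_derivative u (at 0 within edge_dom G e) \<and>
    (vector_derivative u (at 0 within edge_dom G e) = 0 \<longrightarrow> (\<forall>x\<in>edge_dom G e. u x = u 0))"
proof -
  obtain L where L: "0 < L" "{0..L} \<subseteq> edge_dom G e" "u \<in> sobolev_inf 2 {0<..<L}"
    "edge_dom G e \<subseteq> {0..}" "at 0 within edge_dom G e = at_right 0"
    using pos
  proof (cases rule: edge_cases)
    case (bounded L)
    then show thesis
      using W2 by (intro that[of L]) (auto simp: W2inf_loc_edge_def at_within_Icc_at_right)
  next
    case halfline
    \<comment> \<open>Any positive length would serve here.\<close>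
    then show thesis
      using W2 by (intro that[of 1]) (auto simp: W2inf_loc_edge_def at_within_Ici_at_right)
  qed
  have contL: "continuous_on {0..L} u"
    using cont L(2) by (rule continuous_on_subset)
  obtain M where M: "0 \<le> M" "\<And>a h. 0 < h \<Longrightarrow> 0 < a - h \<Longrightarrow> a + h < L \<Longrightarrow>
      - (2 * M * h\<^sup>2) \<le> u (a + h) + u (a - h) - 2 * u a"
    using second_difference_ge[OF L(3) contL] by auto
  obtain D where D: "0 \<le> D" "(u has_real_derivative D) (at_right 0)" "D = 0 \<Longrightarrow> \<forall>x\<in>edge_dom G e. u x = u 0"
    using right_derivative_at_min[OF conc L(1,2,4) contL M(2) \<open>u 0 < 0\<close> min M(1)] by blast
  have "vector_derivative u (at 0 within edge_dom G e) = D"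
    unfolding L(5) using D(2)
    by (intro vector_derivative_within) (auto simp: has_real_derivative_iff_has_vector_derivative)
  with D show ?thesis by simp
qed

text \<open>The reflection x \<mapsto> L - x moves the far end to 0 and reverses the sign of the
  derivative, matching the outgoing orientation.\<close>

lemma derivative_at_tgt_if_min:
  assumes "0 < L" "len G e = ereal L" and cont: "continuous_on (edge_dom G e) u" and W2: "u \<in> W2inf_loc_edge G e"
    and conc: "concave_on (edge_dom G e) (\<lambda>x. min (u x) 0)"
    and "u L < 0" and min: "\<And>x. x \<in> edge_dom G e \<Longrightarrow> u L \<le> u x"
  shows "0 \<le> - vector_derivative u (at L within edge_dom G e) \<and>
    (- vector_derivative u (at L within edge_dom G e) = 0 \<longrightarrow> (\<forall>x\<in>edge_dom G e. u x = u L))"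
proof -
  have dom: "edge_dom G e = {0..L}" and int: "edge_interior G e = {0<..<L}"
    using assms(2) by (auto simp: edge_dom_def edge_interior_def)
  have contL: "continuous_on {0..L} u"
    using cont by (simp add: dom)
  have "u \<in> sobolev_inf 2 {0<..<L}"
    using W2 assms(2) by (simp add: W2inf_loc_edge_def int)
  then obtain M where M: "0 \<le> M" "\<And>a h. 0 < h \<Longrightarrow> 0 < a - h \<Longrightarrow> a + h < L \<Longrightarrow>
      - (2 * M * h\<^sup>2) \<le> u (a + h) + u (a - h) - 2 * u a"
    using second_difference_ge[OF _ contL] by auto
  define v where "v x = u (L - x)" for x
  have "\<exists>D\<ge>0. (v has_real_derivative D) (at_right 0) \<and> (D = 0 \<longrightarrow> (\<forall>x\<in>{0..L}. v x = v 0))"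
  proof (rule right_derivative_at_min[where L = L and M = M])
    show "concave_on {0..L} (\<lambda>x. min (v x) 0)"
      unfolding concave_on_iff
    proof (intro conjI ballI allI impI)
      fix x y s t :: real
      assume xy: "x \<in> {0..L}" "y \<in> {0..L}" and st: "0 \<le> s" "0 \<le> t" "s + t = 1"
      have "s * min (u (L - x)) 0 + t * min (u (L - y)) 0 \<le> min (u (s *\<^sub>R (L - x) + t *\<^sub>R (L - y))) 0"
        using conc xy st unfolding dom concave_on_iff by auto
      also have "s *\<^sub>R (L - x) + t *\<^sub>R (L - y) = (s + t) * L - (s *\<^sub>R x + t *\<^sub>R y)"
        by (simp add: algebra_simps)
      finally show "s * min (v x) 0 + t * min (v y) 0 \<le> min (v (s *\<^sub>R x + t *\<^sub>R y)) 0"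
        by (simp add: v_def st)
    qed simp
    show "continuous_on {0..L} v"
      unfolding v_def[abs_def] by (rule continuous_on_compose2[OF contL]) (auto intro!: continuous_intros)
    fix a h assume "0 < h" "0 < a - h" "a + h < L"
    then show "- (2 * M * h\<^sup>2) \<le> v (a + h) + v (a - h) - 2 * v a"
      using M(2)[of h "L - a"] by (simp add: v_def algebra_simps)
  qed (use assms M(1) dom in \<open>auto simp: v_def\<close>)
  then obtain D where D: "0 \<le> D" "(v has_real_derivative D) (at_right 0)" "D = 0 \<Longrightarrow> \<forall>x\<in>{0..L}. v x = v 0"
    by blast
  have "((\<lambda>x. v (L - x)) has_real_derivative D * (0 - 1)) (at L within {0..L})"
  proof (rule DERIV_image_chain[of v D "\<lambda>x. L - x", unfolded comp_def])
    have "(-) L ` {0..L} = {0..L}"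
      by (auto simp: image_iff intro!: bexI[of _ "L - _"])
    then show "(v has_real_derivative D) (at (L - L) within (\<lambda>x. L - x) ` {0..L})"
      using D(2) \<open>0 < L\<close> by (simp add: at_within_Icc_at_right)
    show "((\<lambda>x. L - x) has_real_derivative (0 - 1)) (at L within {0..L})"
      by (intro derivative_intros)
  qed
  then have "(u has_real_derivative - D) (at L within {0..L})"
    by (simp add: v_def)
  then have vd: "vector_derivative u (at L within {0..L}) = - D"
    using \<open>0 < L\<close>
    by (intro vector_derivative_within) (auto simp: has_real_derivative_iff_has_vector_derivative at_within_Icc_at_left)
  have "\<forall>x\<in>{0..L}. u x = u L" if "D = 0"
  proof
    fix x assume "x \<in> {0..L}"
    then show "u x = u L"
      using D(3)[OF that, rule_format, of "L - x"] by (simp add: v_def)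
  qed
  then show ?thesis
    unfolding dom vd minus_minus using D(1) by blast
qed

subsection \<open>The maximum principle\<close>

theorem proposition2p11:
  fixes G :: "('v, 'e) metric_graph"
    and W \<phi> :: "('v, 'e) point \<Rightarrow> real"
  assumes "Gfin G"
    and "W \<in> Linf_loc_graph G"
    and "AE_graph G (\<lambda>p. W p \<ge> 0)"
    and "continuous_map (graph_topology G) euclideanreal \<phi>"
    and "\<And>e. e \<in> edges G \<Longrightarrow> on_edge G e \<phi> \<in> W2inf_loc_edge G e"
    and "\<And>e. e \<in> edges G \<Longrightarrow>
           AE x\<in>edge_interior G e in lebesgue.
             - weak_deriv 2 (edge_interior G e) (on_edge G e \<phi>) x
               + on_edge G e W x * on_edge G e \<phi> x \<ge> 0"
    and "\<And>v. v \<in> verts G \<Longrightarrow> \<phi> (Vertex v) < 0 \<Longrightarrow> outgoing_deriv_sum G \<phi> v \<le> 0"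
  shows "((\<forall>p\<in>points G. \<phi> p \<ge> 0) \<or>
          (\<exists>C<0. (\<forall>p\<in>points G. \<phi> p = C) \<and> AE_graph G (\<lambda>p. W p = 0)) \<or>
          (INF p\<in>points G. ereal (\<phi> p)) = -\<infinity>) \<and>
         ((INF p\<in>points G. ereal (\<phi> p)) = -\<infinity> \<longrightarrow>
          (\<exists>e\<in>edges G. len G e = \<infinity> \<and> filterlim (on_edge G e \<phi>) at_bot at_top))"
proof -

  \<comment> \<open>Concavity of the truncated function along every edge\<close>
  let ?u = "\<lambda>e. on_edge G e \<phi>"
  let ?m = "\<lambda>e x. min (on_edge G e \<phi> x) 0"
  let ?wd = "\<lambda>e. weak_deriv 2 (edge_interior G e) (on_edge G e \<phi>)"
  have fin: "finite (verts G)" "verts G \<noteq> {}" "finite (edges G)"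
    and len: "\<And>e. e \<in> edges G \<Longrightarrow> 0 < len G e"
    and src: "\<And>e. e \<in> edges G \<Longrightarrow> src G e \<in> verts G"
    and tgt: "\<And>e. e \<in> edges G \<Longrightarrow> len G e < \<infinity> \<Longrightarrow> tgt G e \<in> verts G"
    and conn: "connected_space (graph_topology G)"
    using assms(1) by (auto simp: Gfin_def)
  have cont: "continuous_on (edge_dom G e) (?u e)" if "e \<in> edges G" for e
    using assms(4) that by (rule continuous_on_on_edge)
  have wd: "is_weak_deriv 2 (edge_interior G e) (?u e) (?wd e)" if "e \<in> edges G" for e
    using len[OF that] assms(5)[OF that] by (rule is_weak_deriv_edge)
  have W_nonneg: "AE x in lebesgue. x \<in> edge_interior G e \<longrightarrow> 0 \<le> on_edge G e W x" if "e \<in> edges G" for e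
  proof -
    have "AE x\<in>edge_dom G e in lebesgue. 0 \<le> on_edge G e W x"
      using assms(3) that by (simp add: AE_graph_def on_edge_def)
    then show ?thesis
      by eventually_elim (use edge_interior_subset[of G e, OF len[OF that]] in auto)
  qed
  have conc: "concave_on (edge_dom G e) (?m e)" if e: "e \<in> edges G" for e
  proof (rule concave_on_min_0_if_weak_deriv_nonpos[OF wd[OF e]])
    show "AE x in lebesgue. x \<in> edge_interior G e \<longrightarrow> ?u e x < 0 \<longrightarrow> ?wd e x \<le> 0"
      using W_nonneg[OF e] assms(6)[OF e]
    proof eventually_elim
      case (elim x)
      show ?case
      proof (intro impI)
        assume "x \<in> edge_interior G e" "?u e x < 0"
        then have "on_edge G e W x * ?u e x \<le> 0" "?wd e x \<le> on_edge G e W x * ?u e x"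
          using elim by (auto intro: mult_nonneg_nonpos)
        then show "?wd e x \<le> 0" by linarith
      qed
    qed
  qed (use e len cont edge_geometry[of G e] in auto)
  have src_val: "?u e 0 = \<phi> (Vertex (src G e))" for e
    by (simp add: on_edge_def edge_point_def)
  have tgt_val: "?u e L = \<phi> (Vertex (tgt G e))" if "len G e = ereal L" "0 < L" for e L
    using that by (simp add: on_edge_def edge_point_def)
  have point_in: "edge_point G e x \<in> points G" if "e \<in> edges G" "x \<in> edge_dom G e" for e x
    using that by (auto simp: points_def)

  show ?thesis
  proof (cases "\<exists>e\<in>edges G. len G e = \<infinity> \<and> filterlim (?u e) at_bot at_top")

    \<comment> \<open>A half-line along which \<phi> tends to minus infinity\<close>
    case True
    then obtain e where e: "e \<in> edges G" "len G e = \<infinity>" "filterlim (?u e) at_bot at_top"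
      by blast
    have "(INF p\<in>points G. ereal (\<phi> p)) = - \<infinity>"
    proof (rule ccontr)
      assume "(INF p\<in>points G. ereal (\<phi> p)) \<noteq> - \<infinity>"
      then have "- \<infinity> < (INF p\<in>points G. ereal (\<phi> p))" by simp
      then obtain B where B: "ereal B < (INF p\<in>points G. ereal (\<phi> p))"
        using ereal_dense2 by blast
      have "\<forall>\<^sub>F x in at_top. ?u e x < B \<and> 0 \<le> x"
        using e(3) eventually_ge_at_top by (auto simp: filterlim_at_bot_dense intro: eventually_conj)
      then obtain x where x: "?u e x < B" "0 \<le> x"
        using eventually_happens'[OF trivial_limit_at_top_linorder] by blast
      have "(INF p\<in>points G. ereal (\<phi> p)) \<le> ereal (\<phi> (edge_point G e x))"
        using x(2) e by (intro INF_lower point_in) (auto simp: edge_dom_def)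
      then have "ereal B < ereal (?u e x)"
        unfolding on_edge_def by (rule less_le_trans[OF B])
      with x(1) show False by simp
    qed
    with True show ?thesis by blast
  next

    \<comment> \<open>A lower bound given by the vertex values\<close>
    case False
    \<comment> \<open>Truncation gives m \<le> 0, and m < 0 exactly when \<phi> is negative at some
      vertex.\<close>
    define m where "m = Min ((\<lambda>v. min (\<phi> (Vertex v)) 0) ` verts G)"
    have m_vertex: "m \<le> min (\<phi> (Vertex v)) 0" if "v \<in> verts G" for v
      unfolding m_def using that fin by (intro Min_le) auto
    have m_edge: "m \<le> ?m e x" if e: "e \<in> edges G" and x: "x \<in> edge_dom G e" for e x
      using len[OF e]
    proof (cases rule: edge_cases)
      case (bounded L)
      have "min (?m e 0) (?m e L) \<le> ?m e x"
        using conc[OF e] x bounded by (intro concave_on_ge_min_ends) auto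
      moreover have "m \<le> ?m e 0"
        unfolding src_val using src[OF e] by (rule m_vertex)
      moreover have "m \<le> ?m e L"
        unfolding tgt_val[OF bounded(2,1)] using tgt[OF e] bounded by (intro m_vertex) auto
      ultimately show ?thesis by (meson min.boundedI order_trans)
    next
      case halfline
      have "\<not> filterlim (?m e) at_bot at_top"
      proof
        assume bot: "filterlim (?m e) at_bot at_top"
        have "filterlim (?u e) at_bot at_top"
          unfolding filterlim_at_bot
        proof
          fix Z
          \<comment> \<open>Below -1 the truncated value is \<phi> itself.\<close>
          have "\<forall>\<^sub>F x in at_top. ?m e x \<le> min Z (- 1)"
            using bot unfolding filterlim_at_bot by blast
          then show "\<forall>\<^sub>F x in at_top. ?u e x \<le> Z"
            by eventually_elim (auto simp: min_def split: if_splits)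
        qed
        with False e halfline show False by blast
      qed
      then have "?m e 0 \<le> ?m e x"
        using concave_on_halfline_dichotomy[of "?m e"] conc[OF e] halfline x by auto
      moreover have "m \<le> ?m e 0"
        unfolding src_val using src[OF e] by (rule m_vertex)
      ultimately show ?thesis by linarith
    qed
    have m_points: "m \<le> min (\<phi> p) 0" if "p \<in> points G" for p
      using that m_vertex m_edge by (auto simp: points_def on_edge_def)
    \<comment> \<open>The finite lower bound m excludes the third alternative and makes the final
      implication vacuous.\<close>
    have not_minf: "(INF p\<in>points G. ereal (\<phi> p)) \<noteq> - \<infinity>"
    proof -
      have "ereal m \<le> (INF p\<in>points G. ereal (\<phi> p))"
        using m_points by (intro INF_greatest) simp
      then show ?thesis by auto
    qed
    show ?thesis
    proof (cases "m < 0")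
      case False
      then have "\<forall>p\<in>points G. 0 \<le> \<phi> p"
        using m_points by (smt (verit))
      with not_minf show ?thesis by blast
    next

      \<comment> \<open>Outgoing derivatives at minimising vertices\<close>
      case True
      have m_le: "m \<le> \<phi> p" if "p \<in> points G" for p
        using m_points[OF that] by simp
      have m_le_edge: "m \<le> ?u e x" if "e \<in> edges G" "x \<in> edge_dom G e" for e x
        using m_edge[OF that] by simp
      obtain v0 where v0: "v0 \<in> verts G" "\<phi> (Vertex v0) = m"
      proof -
        have "m \<in> (\<lambda>v. min (\<phi> (Vertex v)) 0) ` verts G"
          unfolding m_def using fin by (intro Min_in) auto
        then show thesis
          using True that by (auto simp: min_def split: if_splits)
      qed
      \<comment> \<open>\<open>S\<close> and \<open>T\<close> are the two kinds of summands in the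
        vertex condition, both directed away from the vertex.\<close>
      define S where "S e = vector_derivative (?u e) (at 0 within edge_dom G e)" for e
      define T where "T e = - vector_derivative (?u e) (at (real_of_ereal (len G e)) within edge_dom G e)" for e
      have S: "0 \<le> S e \<and> (S e = 0 \<longrightarrow> (\<forall>x\<in>edge_dom G e. ?u e x = m))"
        if e: "e \<in> edges G" and min: "\<phi> (Vertex (src G e)) = m" for e
      proof -
        have "?u e 0 = m"
          using min src_val by simp
        then show ?thesis
          using derivative_at_src_if_min[OF len[OF e] cont[OF e] assms(5)[OF e] conc[OF e]]
            True m_le_edge[OF e] unfolding S_def by auto
      qed
      have T: "0 \<le> T e \<and> (T e = 0 \<longrightarrow> (\<forall>x\<in>edge_dom G e. ?u e x = m))"
        if e: "e \<in> edges G" and bd: "len G e < \<infinity>" and min: "\<phi> (Vertex (tgt G e)) = m" for e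
        using len[OF e]
      proof (cases rule: edge_cases)
        case (bounded L)
        have "?u e L = m"
          using min tgt_val[OF bounded(2,1)] by simp
        then show ?thesis
          using derivative_at_tgt_if_min[OF bounded(1,2) cont[OF e] assms(5)[OF e] conc[OF e]]
            True m_le_edge[OF e] bounded(2) unfolding T_def by auto
      qed (use bd in auto)
      \<comment> \<open>Nonnegative terms with a nonpositive sum all vanish. A loop takes part in
        both sums.\<close>
      have vertex: "(\<forall>e\<in>edges G. src G e = v \<longrightarrow> S e = 0) \<and>
          (\<forall>e\<in>edges G. len G e < \<infinity> \<longrightarrow> tgt G e = v \<longrightarrow> T e = 0)"
        if v: "v \<in> verts G" "\<phi> (Vertex v) = m" for v
      proof -
        let ?A = "{e \<in> edges G. src G e = v}" and ?B = "{e \<in> edges G. len G e < \<infinity> \<and> tgt G e = v}"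
        have nonneg: "\<And>e. e \<in> ?A \<Longrightarrow> 0 \<le> S e" "\<And>e. e \<in> ?B \<Longrightarrow> 0 \<le> T e"
          using S T v(2) by auto
        have "sum S ?A + sum T ?B \<le> 0"
          using assms(7)[OF v(1)] v(2) True by (simp add: outgoing_deriv_sum_def S_def T_def)
        moreover have "0 \<le> sum S ?A" "0 \<le> sum T ?B"
          using nonneg by (auto intro: sum_nonneg)
        ultimately have "sum S ?A = 0" "sum T ?B = 0"
          by linarith+
        moreover have "finite ?A" "finite ?B"
          using fin(3) by simp_all
        ultimately have "\<forall>e\<in>?A. S e = 0" "\<forall>e\<in>?B. T e = 0"
          using sum_nonneg_eq_0_iff[of ?A S, OF _ nonneg(1)] sum_nonneg_eq_0_iff[of ?B T, OF _ nonneg(2)]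
          by blast+
        then show ?thesis by auto
      qed

      \<comment> \<open>Propagation of the minimum along an edge\<close>
      have edge_const: "\<forall>y\<in>edge_dom G e. ?u e y = m"
        if e: "e \<in> edges G" and x: "x \<in> edge_dom G e" "?u e x = m" for e x
      proof -
        have src_case: ?thesis if "?u e 0 = m"
          using S[OF e] vertex[OF src[OF e]] that e by (simp add: src_val)
        \<comment> \<open>Since m < 0, constancy of the truncation at m carries over to
          \<phi>.\<close>
        have interior_case: ?thesis if pq: "p \<in> edge_dom G e" "p < x" "q \<in> edge_dom G e" "x < q" for p q
        proof
          fix y assume y: "y \<in> edge_dom G e"
          have "?m e y = ?m e x"
            using m_edge[OF e] x True by (intro concave_on_interior_min_imp_const[OF conc[OF e] _ pq y]) auto
          then show "?u e y = m"
            using x(2) True by (auto simp: min_def split: if_splits)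
        qed
        show ?thesis
          using len[OF e]
        proof (cases rule: edge_cases)
          case (bounded L)
          consider "x = 0" | "x = L" | "0 < x" "x < L"
            using x(1) bounded by fastforce
          then show ?thesis
          proof cases
            case 2
            then have "\<phi> (Vertex (tgt G e)) = m"
              using x(2) tgt_val[OF bounded(2,1)] by simp
            then show ?thesis
              using T[OF e] vertex[OF tgt[OF e]] e bounded by simp
          qed (use src_case interior_case[of 0 L] x bounded in auto)
        next
          case halfline
          then show ?thesis
            using src_case interior_case[of 0 "x + 1"] x by (cases "x = 0") auto
        qed
      qed

      \<comment> \<open>Propagation of the minimum through the connected graph\<close>
      define Z where "Z = {p \<in> points G. \<phi> p = m}"
      have "openin (graph_topology G) Z" "openin (graph_topology G) (points G - Z)"
      proof -
        \<comment> \<open>Every edge meets the minimum set entirely or not at all, so preimages of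
          this set and of its complement are trivially open.\<close>
        have "{x \<in> edge_dom G e. edge_point G e x \<in> Z} = {} \<and> {x \<in> edge_dom G e. edge_point G e x \<in> points G - Z} = edge_dom G e \<or>
            {x \<in> edge_dom G e. edge_point G e x \<in> Z} = edge_dom G e \<and> {x \<in> edge_dom G e. edge_point G e x \<in> points G - Z} = {}"
          if e: "e \<in> edges G" for e
        proof (cases "\<exists>x\<in>edge_dom G e. ?u e x = m")
          case True
          then have "\<forall>y\<in>edge_dom G e. ?u e y = m"
            using edge_const[OF e] by blast
          then show ?thesis
            using point_in[OF e] by (auto simp: Z_def on_edge_def)
        next
          case False
          then show ?thesis
            using point_in[OF e] by (auto simp: Z_def on_edge_def)
        qed
        note alt = this
        show "openin (graph_topology G) Z"
          unfolding openin_graph_topology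
        proof (intro conjI ballI)
          fix e assume "e \<in> edges G"
          from alt[OF this] show "openin (top_of_set (edge_dom G e)) {x \<in> edge_dom G e. edge_point G e x \<in> Z}"
            by (metis (lifting) openin_empty openin_subtopology_self)
        qed (simp add: Z_def)
        show "openin (graph_topology G) (points G - Z)"
          unfolding openin_graph_topology
        proof (intro conjI ballI)
          fix e assume "e \<in> edges G"
          from alt[OF this] show "openin (top_of_set (edge_dom G e)) {x \<in> edge_dom G e. edge_point G e x \<in> points G - Z}"
            by (metis (lifting) openin_empty openin_subtopology_self)
        qed simp
      qed
      then have "openin (graph_topology G) Z \<and> closedin (graph_topology G) Z"
        by (auto simp: closedin_def topspace_graph_topology Z_def)
      then have "Z = {} \<or> Z = points G"
        using conn by (metis connected_space_clopen_in topspace_graph_topology)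
      moreover have "Vertex v0 \<in> Z"
        using v0 by (simp add: Z_def points_def)
      ultimately have const: "\<phi> p = m" if "p \<in> points G" for p
        using that by (auto simp: Z_def)

      \<comment> \<open>Vanishing of W\<close>
      have "AE_graph G (\<lambda>p. W p = 0)"
        unfolding AE_graph_def
      proof
        fix e assume e: "e \<in> edges G"
        have u: "?u e x = m" if "x \<in> edge_dom G e" for x
          using const[OF point_in[OF e that]] by (simp add: on_edge_def)
        have I: "open (edge_interior G e)" "edge_interior G e \<subseteq> edge_dom G e"
          using edge_geometry[of G e] len[OF e] by auto
        \<comment> \<open>With vanishing second derivative the differential inequality reads W m
          \<ge> 0, while m < 0 and W \<ge> 0.\<close>
        have "AE x in lebesgue. x \<in> edge_interior G e \<longrightarrow> ?wd e x = 0"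
          by (rule weak_second_deriv_const[OF wd[OF e] _ I(1)]) (use u I(2) in blast)
        \<comment> \<open>Removing the ends passes from the closed edge to its interior. On a
          half-line \<open>real_of_ereal\<close> sends infinity to 0, so both exclusions
          coincide.\<close>
        moreover have "AE x in lebesgue. x \<noteq> 0" "AE x in lebesgue. x \<noteq> real_of_ereal (len G e)"
          by (auto intro: AE_completion[OF AE_lborel_singleton])
        ultimately show "AE x\<in>edge_dom G e in lebesgue. W (edge_point G e x) = 0"
          using assms(6)[OF e] W_nonneg[OF e]
        proof eventually_elim
          case (elim x)
          show ?case
          proof
            assume x: "x \<in> edge_dom G e"
            then have xI: "x \<in> edge_interior G e"
              using elim(2,3) by (cases rule: edge_cases[OF len[OF e]]) auto
            then have "0 \<le> on_edge G e W x * m" "0 \<le> on_edge G e W x"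
              using elim u[OF x] by auto
            then have "on_edge G e W x = 0"
              using True by (simp add: zero_le_mult_iff)
            then show "W (edge_point G e x) = 0"
              by (simp add: on_edge_def)
          qed
        qed
      qed
      with const True not_minf show ?thesis by blast
    qed
  qed
qed

end
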